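(* Let $K$ be a field of characteristic $p>0$ and let $G$ be a group such that the group algebra $KG$ is Lie nilpotent. If $t^{L}(KG)=|G'|+1$, then $t_{L}(KG)=t^{L}(KG)$.
   Context: Let $R$ be an associative algebra with identity. Put $[x,y]=xy-yx$ and $[x_1,\ldots,x_{n}]=[[x_1,\ldots,x_{n-1}],x_{n}]$. The $n$-th lower Lie power $R^{[n]}$ is the associative (two-sided) ideal generated by all $[x_1,\ldots,x_n]$ with $x_i\in R$, where $R^{[1]}=R$. The $n$-th upper Lie power $R^{(n)}$ is defined inductively: $R^{(1)}=R$, and $R^{(n)}$ is the associative (two-sided) ideal generated by all $[x,y]$ with $x\in R^{(n-1)}$, $y\in R$. The algebra $R$ is Lie nilpotent if $R^{[m]}=0$ for some $m$. The minimal integers $m,n$ with $R^{[m]}=0$ and $R^{(n)}=0$ are the Lie nilpotency index $t_L(R)$ and the upper Lie nilpotency index $t^L(R)$, respectively. $G'$ denotes the commutator subgroup of $G$. Known facts: for $KG$ noncommutative with $K$ of characteristic $p>0$, $KG$ is Lie nilpotent if and only if $G$ is nilpotent and $G'$ is a finite $p$-group; and if $KG$ is Lie nilpotent then $t_L(KG)\le t^L(KG)\le |G'|+1$. *)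

theory Defs
  imports "HOL-Library.Poly_Mapping" "HOL-Library.Extended_Nat" "HOL-Computational_Algebra.Computational_Algebra"
begin

text \<open>
  Class \<^class>\<open>group_add\<close> does not assume commutativity, so a type of this class is an arbitrary
  group, written additively. The multiplication of \<^typ>\<open>'g \<Rightarrow>\<^sub>0 'k\<close> is convolution along the
  operation of \<^typ>\<open>'g\<close>, which makes it the group algebra over \<^typ>\<open>'k\<close>; the group element \<open>g\<close> is
  \<open>Poly_Mapping.single g 1\<close>.
\<close>

type_synonym ('g, 'k) group_algebra = "'g \<Rightarrow>\<^sub>0 'k"

definition subgroup_add :: "'g::group_add set \<Rightarrow> bool" where
  "subgroup_add H \<longleftrightarrow> 0 \<in> H \<and> (\<forall>x\<in>H. \<forall>y\<in>H. x + y \<in> H) \<and> (\<forall>x\<in>H. - x \<in> H)"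

definition commutator_subgroup :: "'g::group_add set" where
  "commutator_subgroup = subgroup_add hull {- x + - y + x + y | x y. True}"

text \<open>
  In an algebra with identity a two-sided ideal is automatically closed under scalars, so the
  scalar field plays no role in the following notions. Closure under negation is the case \<open>r = - 1\<close>.
\<close>

definition two_sided_ideal :: "'a::ring_1 set \<Rightarrow> bool" where
  "two_sided_ideal I \<longleftrightarrow> 0 \<in> I \<and> (\<forall>x\<in>I. \<forall>y\<in>I. x + y \<in> I) \<and>
     (\<forall>x\<in>I. \<forall>r. r * x \<in> I \<and> x * r \<in> I)"

definition lie_bracket :: "'a::ring_1 \<Rightarrow> 'a \<Rightarrow> 'a" where
  "lie_bracket x y = x * y - y * x"

text \<open>
  \<open>foldl lie_bracket x xs\<close> is the left-normed commutator of the entries of \<open>x # xs\<close>. In both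
  Lie power series the index \<open>0\<close> is meaningless.
\<close>

definition lower_lie_power :: "nat \<Rightarrow> 'a::ring_1 set" where
  "lower_lie_power n =
     two_sided_ideal hull {foldl lie_bracket x xs | x xs. length (x # xs) = n}"

fun upper_lie_power :: "nat \<Rightarrow> 'a::ring_1 set" where
  "upper_lie_power 0 = UNIV"
| "upper_lie_power (Suc 0) = UNIV"
| "upper_lie_power (Suc (Suc n)) =
     two_sided_ideal hull {lie_bracket x y | x y. x \<in> upper_lie_power (Suc n)}"

definition lie_nilpotent :: "'a::ring_1 itself \<Rightarrow> bool" where
  "lie_nilpotent _ \<longleftrightarrow> (\<exists>m\<ge>1. lower_lie_power m = ({0} :: 'a set))"

text \<open>
  The indices are \<open>\<infinity>\<close> if no power vanishes, since the infimum of the empty set is \<open>\<infinity>\<close> in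
  \<^typ>\<open>enat\<close>.
\<close>

definition lie_nilpotency_index :: "'a::ring_1 itself \<Rightarrow> enat" where
  "lie_nilpotency_index _ = (INF m\<in>{m. 1 \<le> m \<and> lower_lie_power m = ({0} :: 'a set)}. enat m)"

definition upper_lie_nilpotency_index :: "'a::ring_1 itself \<Rightarrow> enat" where
  "upper_lie_nilpotency_index _ =
     (INF n\<in>{n. 1 \<le> n \<and> upper_lie_power n = ({0} :: 'a set)}. enat n)"

end

theory Submission
  imports Defs
begin

text \<open>
  Let \<open>R = KG\<close>, let \<open>V k\<close> be the upper Lie power \<open>R\<^sup>(\<^sup>k\<^sup>+\<^sup>1\<^sup>)\<close>, and let \<open>P\<close> be the commutator subgroup
  \<open>G'\<close>.  The hypothesis on the upper index says that \<open>V \<bar>P\<bar> = 0\<close> but \<open>V (\<bar>P\<bar> - 1) \<noteq> 0\<close>.  Lower Lie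
  powers are contained in upper ones, so it suffices to find a nonzero left-normed commutator
  with \<open>\<bar>P\<bar>\<close> entries.  It will have the form \<open>[b, a, \<dots>, a]\<close> with group elements \<open>a\<close> and \<open>b\<close>,
  once \<open>P\<close> is known to be cyclic or a noncentral Klein four group.

  For a normal subgroup \<open>N\<close> let \<open>J N\<close> be the ideal generated by the elements \<open>h - 1\<close> with \<open>h \<in> N\<close>;
  then \<open>V 1 = J P\<close>.  Since \<open>V i V j \<subseteq> V (i + j)\<close> and \<open>V \<bar>P\<bar> = 0\<close>, the group \<open>P\<close> is a \<open>p\<close>-group, and
  \<open>G\<close> acts nilpotently on it.  If \<open>M \<subseteq> N \<subseteq> P\<close> are normal in \<open>G\<close> and \<open>N/M\<close> has order \<open>p\<close> and is
  generated by the class of \<open>z\<close>, then \<open>z\<close> is central modulo \<open>M\<close>, so that \<open>J N = (z - 1) R + J M\<close>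
  with \<open>z - 1\<close> central modulo \<open>J M\<close> and \<open>(z - 1)\<^sup>p \<in> J M\<close>.  Hence \<open>V k \<subseteq> J N\<close> implies
  \<open>V (k p) \<subseteq> J M\<close>, and \<open>V k \<subseteq> J N\<close> implies \<open>V (k \<bar>N\<bar>) = 0\<close> by descending along a chief series
  (\<open>lie_filtration_lift_normal\<close>).  By the hypothesis \<open>V (\<bar>P/M\<bar> - 1)\<close> is therefore not contained in
  \<open>J M\<close>, for any normal subgroup \<open>M \<subseteq> P\<close> of \<open>G\<close>.

  Suppose that \<open>P\<close> is not cyclic.  Then there is \<open>M\<close> with \<open>P/M\<close> elementary abelian of order \<open>p\<^sup>2\<close>, and
  a count of commutators gives \<open>V (p\<^sup>2 - 1) \<subseteq> J M\<close> unless \<open>p = 2\<close> and \<open>P/M\<close> is not central in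
  \<open>G/M\<close> (\<open>V_subset_aug_of_rank_two\<close>).  In the exceptional case, if \<open>M\<close> is not trivial and \<open>L \<subseteq> M\<close> is
  normal in \<open>G\<close> and of index 2 in \<open>M\<close>, then \<open>V 7 \<subseteq> J L\<close>, where \<open>P/L\<close> has order 8 (\<open>V_7_subset_aug_of_three_steps\<close>).  Only the
  noncentral Klein four group survives (\<open>not_cyclic_cases\<close>).

  If \<open>P\<close> is cyclic, it is generated by a single commutator \<open>c = (b, a)\<close>, where \<open>a\<close> can be chosen to
  act on \<open>P\<close> so weakly that \<open>[c - 1, a] \<in> V 3\<close>.  Then \<open>[b, a, \<dots>, a]\<close> with \<open>k\<close> entries \<open>a\<close> agrees with
  \<open>a\<^sup>k b (c - 1)\<^sup>k\<close> modulo \<open>V (k + 1)\<close>.  For \<open>k = \<bar>P\<bar> - 1\<close> the error term vanishes and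
  \<open>(c - 1)\<^sup>k \<noteq> 0\<close>.  If \<open>P\<close> is a noncentral Klein four group, one can choose \<open>a\<close> and \<open>b\<close> such that
  \<open>c = (b, a)\<close> and \<open>d = (c, a)\<close> generate \<open>P\<close>; then \<open>[b, a, a, a] = a\<^sup>2 b a (c - 1) (d - 1) \<noteq> 0\<close>.

  Explanations write groups multiplicatively, formulas additively.
\<close>

section \<open>Two-sided ideals\<close>

lemma two_sided_ideal_zero: "two_sided_ideal I \<Longrightarrow> 0 \<in> I"
  and two_sided_ideal_add: "two_sided_ideal I \<Longrightarrow> x \<in> I \<Longrightarrow> y \<in> I \<Longrightarrow> x + y \<in> I"
  and two_sided_ideal_mult_left: "two_sided_ideal I \<Longrightarrow> x \<in> I \<Longrightarrow> r * x \<in> I"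
  and two_sided_ideal_mult_right: "two_sided_ideal I \<Longrightarrow> x \<in> I \<Longrightarrow> x * r \<in> I"
  by (auto simp: two_sided_ideal_def)

lemma two_sided_ideal_uminus: "two_sided_ideal I \<Longrightarrow> x \<in> I \<Longrightarrow> - x \<in> I"
  using two_sided_ideal_mult_left[of I x "- 1"] by simp

lemma two_sided_ideal_diff: "two_sided_ideal I \<Longrightarrow> x \<in> I \<Longrightarrow> y \<in> I \<Longrightarrow> x - y \<in> I"
  using two_sided_ideal_add[of I x "- y"] two_sided_ideal_uminus[of I y] by simp

lemmas two_sided_ideal_closed =
  two_sided_ideal_zero two_sided_ideal_add two_sided_ideal_mult_left two_sided_ideal_mult_right
  two_sided_ideal_uminus two_sided_ideal_diff

lemma two_sided_ideal_UNIV: "two_sided_ideal UNIV"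
  by (simp add: two_sided_ideal_def)

lemma two_sided_ideal_singleton_zero: "two_sided_ideal {0}"
  by (simp add: two_sided_ideal_def)

lemma two_sided_ideal_hull: "two_sided_ideal (two_sided_ideal hull S)"
  by (rule hull_in) (auto simp: two_sided_ideal_def)

lemma two_sided_ideal_bracket:
  "two_sided_ideal I \<Longrightarrow> x \<in> I \<Longrightarrow> lie_bracket x r \<in> I"
  by (simp add: lie_bracket_def two_sided_ideal_closed)

lemma two_sided_ideal_power:
  assumes "two_sided_ideal I" "x \<in> I" "0 < k"
  shows "x ^ k \<in> I"
  using assms by (cases k) (auto intro: two_sided_ideal_mult_right)

lemma lie_bracket_add_left: "lie_bracket (x + y) z = lie_bracket x z + lie_bracket y z"
  and lie_bracket_add_right: "lie_bracket x (y + z) = lie_bracket x y + lie_bracket x z"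
  and lie_bracket_diff_left: "lie_bracket (x - y) z = lie_bracket x z - lie_bracket y z"
  and lie_bracket_mult_left: "lie_bracket (x * y) z = x * lie_bracket y z + lie_bracket x z * y"
  and lie_bracket_mult_right: "lie_bracket x (y * z) = lie_bracket x y * z + y * lie_bracket x z"
  and lie_bracket_zero_left [simp]: "lie_bracket 0 z = 0"
  and lie_bracket_zero_right [simp]: "lie_bracket z 0 = 0"
  and lie_bracket_one_left [simp]: "lie_bracket 1 z = 0"
  and lie_bracket_one_right [simp]: "lie_bracket z 1 = 0"
  by (simp_all add: lie_bracket_def algebra_simps)

text \<open>
  If \<open>z\<close> is central modulo \<open>J\<close>, then \<open>z X + J\<close> is the product of the ideal generated by \<open>z\<close>
  and \<open>J\<close> with \<open>X\<close>, up to \<open>J\<close>.  Working with this explicit form avoids products of ideals.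
\<close>

definition coset_mult :: "'a::ring_1 \<Rightarrow> 'a set \<Rightarrow> 'a set \<Rightarrow> 'a set" where
  "coset_mult z X J = {z * x + j | x j. x \<in> X \<and> j \<in> J}"

lemma coset_multI: "x \<in> X \<Longrightarrow> j \<in> J \<Longrightarrow> z * x + j \<in> coset_mult z X J"
  by (auto simp: coset_mult_def)

lemma coset_multE:
  assumes "u \<in> coset_mult z X J"
  obtains x j where "x \<in> X" "j \<in> J" "u = z * x + j"
  using assms by (auto simp: coset_mult_def)

lemma subset_coset_mult: "0 \<in> X \<Longrightarrow> J \<subseteq> coset_mult z X J"
  by (force simp: coset_mult_def)

lemma mult_in_coset_mult: "two_sided_ideal J \<Longrightarrow> x \<in> X \<Longrightarrow> z * x \<in> coset_mult z X J"
  using coset_multI[of x X 0 J z] by (simp add: two_sided_ideal_zero)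

lemma two_sided_ideal_coset_mult:
  assumes J: "two_sided_ideal J" and X: "two_sided_ideal X"
    and z: "\<And>r. lie_bracket z r \<in> J"
  shows "two_sided_ideal (coset_mult z X J)"
  unfolding two_sided_ideal_def
proof (intro conjI ballI allI)
  show "0 \<in> coset_mult z X J"
    using coset_multI[of 0 X 0 J z] by (simp add: J X two_sided_ideal_zero)
next
  fix u v assume "u \<in> coset_mult z X J" "v \<in> coset_mult z X J"
  then obtain x j x' j' where *: "x \<in> X" "j \<in> J" "u = z * x + j" "x' \<in> X" "j' \<in> J" "v = z * x' + j'"
    by (metis coset_multE)
  have "u + v = z * (x + x') + (j + j')" using * by (simp add: algebra_simps)
  then show "u + v \<in> coset_mult z X J"
    using coset_multI[OF two_sided_ideal_add[OF X] two_sided_ideal_add[OF J], of x x' j j' z] * by metis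
next
  fix u r assume "u \<in> coset_mult z X J"
  then obtain x j where *: "x \<in> X" "j \<in> J" "u = z * x + j" by (rule coset_multE)
  have "r * u = z * (r * x) + (r * j - lie_bracket z r * x)"
    using * by (simp add: lie_bracket_def algebra_simps)
  moreover have "r * j - lie_bracket z r * x \<in> J"
    using * J z by (blast intro: two_sided_ideal_closed)
  ultimately show "r * u \<in> coset_mult z X J"
    using coset_multI[OF two_sided_ideal_mult_left[OF X]] * by metis
  have "u * r = z * (x * r) + j * r" using * by (simp add: algebra_simps)
  then show "u * r \<in> coset_mult z X J"
    using coset_multI[OF two_sided_ideal_mult_right[OF X] two_sided_ideal_mult_right[OF J]] * by metis
qed

section \<open>Upper Lie powers\<close>

declare upper_lie_power.simps(3) [simp del]

text \<open>
  The shift by one makes the filtration multiplicative: degree \<open>k\<close> counts commutators rather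
  than entries of commutators.
\<close>

abbreviation lie_filtration :: "nat \<Rightarrow> 'a::ring_1 set" where
  "lie_filtration k \<equiv> upper_lie_power (Suc k)"

lemma two_sided_ideal_upper_lie_power: "two_sided_ideal (upper_lie_power k)"
  by (induction k rule: upper_lie_power.induct) (simp_all add: upper_lie_power.simps(3) two_sided_ideal_UNIV two_sided_ideal_hull)

lemma bracket_lie_filtration:
  "x \<in> lie_filtration k \<Longrightarrow> lie_bracket x y \<in> lie_filtration (Suc k)"
  by (auto simp: upper_lie_power.simps(3) intro!: hull_inc)

lemma lie_filtration_Suc_least:
  assumes "two_sided_ideal I" "\<And>x y. x \<in> lie_filtration k \<Longrightarrow> lie_bracket x y \<in> I"
  shows "lie_filtration (Suc k) \<subseteq> I"
  unfolding upper_lie_power.simps(3) using assms by (intro hull_minimal) auto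

lemma lie_filtration_Suc_subset: "lie_filtration (Suc k) \<subseteq> lie_filtration k"
  by (rule lie_filtration_Suc_least)
    (auto intro: two_sided_ideal_upper_lie_power two_sided_ideal_bracket)

lemma lie_filtration_antimono: "i \<le> j \<Longrightarrow> lie_filtration j \<subseteq> lie_filtration i"
  using lift_Suc_antimono_le[of lie_filtration i j] lie_filtration_Suc_subset by blast

text \<open>
  The identity \<open>x [u, v] = [x u, v] - [x, v] u\<close> moves one bracket at a time from the right factor
  to the left factor.
\<close>

lemma lie_filtration_mult:
  assumes "x \<in> lie_filtration i" "y \<in> lie_filtration j"
  shows "x * y \<in> lie_filtration (i + j)"
  using assms
proof (induction j arbitrary: i x y)
  case 0
  then show ?case
    using two_sided_ideal_mult_right[OF two_sided_ideal_upper_lie_power] by simp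
next
  case (Suc j)
  let ?V = "lie_filtration :: nat \<Rightarrow> 'a set"
  let ?I = "{y. \<forall>x\<in>?V i. x * y \<in> ?V (i + Suc j)}"
  have V: "two_sided_ideal (?V k)" for k
    by (rule two_sided_ideal_upper_lie_power)
  have "two_sided_ideal ?I"
    unfolding two_sided_ideal_def
  proof (intro conjI ballI allI)
    fix y r assume y: "y \<in> ?I"
    have "x * (r * y) \<in> ?V (i + Suc j)" if "x \<in> ?V i" for x
    proof -
      have "x * r \<in> ?V i" using that V by (blast intro: two_sided_ideal_mult_right)
      then have "(x * r) * y \<in> ?V (i + Suc j)" using y by blast
      then show ?thesis by (simp only: mult.assoc)
    qed
    then show "r * y \<in> ?I" by blast
    have "x * (y * r) \<in> ?V (i + Suc j)" if "x \<in> ?V i" for x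
    proof -
      have "x * y \<in> ?V (i + Suc j)" using y that by blast
      then have "(x * y) * r \<in> ?V (i + Suc j)" using V by (blast intro: two_sided_ideal_mult_right)
      then show ?thesis by (simp only: mult.assoc)
    qed
    then show "y * r \<in> ?I" by blast
  next
    show "0 \<in> ?I" using two_sided_ideal_zero[OF V[of "i + Suc j"]] by simp
  next
    fix y z assume "y \<in> ?I" "z \<in> ?I"
    then show "y + z \<in> ?I"
      using two_sided_ideal_add[OF V[of "i + Suc j"]] by (simp add: distrib_left)
  qed
  moreover have "lie_bracket u v \<in> ?I" if u: "u \<in> ?V j" for u v
  proof -
    have "x * lie_bracket u v \<in> ?V (i + Suc j)" if x: "x \<in> ?V i" for x
    proof -
      have "lie_bracket (x * u) v \<in> ?V (Suc (i + j))"
        by (rule bracket_lie_filtration[OF Suc.IH[OF x u]])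
      moreover have "lie_bracket x v * u \<in> ?V (Suc i + j)"
        by (rule Suc.IH[OF bracket_lie_filtration[OF x] u])
      moreover have "x * lie_bracket u v = lie_bracket (x * u) v - lie_bracket x v * u"
        by (simp add: lie_bracket_mult_left)
      ultimately show ?thesis
        using two_sided_ideal_diff[OF V[of "i + Suc j"]] by simp
    qed
    then show ?thesis by blast
  qed
  ultimately have "?V (Suc j) \<subseteq> ?I" by (rule lie_filtration_Suc_least)
  then show ?case using Suc.prems by blast
qed

lemma lie_filtration_power:
  assumes "x \<in> lie_filtration 1"
  shows "x ^ k \<in> lie_filtration k"
proof (induction k)
  case (Suc k)
  show ?case using lie_filtration_mult[OF assms Suc] by simp
qed simp

text \<open>An element that is central modulo \<open>J\<close> can be pulled out of all further brackets.\<close>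

lemma lie_filtration_shift:
  assumes J: "two_sided_ideal J" and z: "\<And>r. lie_bracket z r \<in> J"
    and "lie_filtration k \<subseteq> coset_mult z (lie_filtration j) J"
  shows "lie_filtration (k + i) \<subseteq> coset_mult z (lie_filtration (j + i)) J"
proof (induction i)
  case (Suc i)
  have "lie_filtration (Suc (k + i)) \<subseteq> coset_mult z (lie_filtration (Suc (j + i))) J"
  proof (rule lie_filtration_Suc_least)
    show "two_sided_ideal (coset_mult z (lie_filtration (Suc (j + i))) J)"
      by (rule two_sided_ideal_coset_mult[OF J two_sided_ideal_upper_lie_power z])
  next
    fix x y :: 'a assume "x \<in> lie_filtration (k + i)"
    then obtain u v where u: "u \<in> lie_filtration (j + i)" and v: "v \<in> J" and x: "x = z * u + v"
      using Suc by (meson coset_multE subsetD)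
    have "lie_bracket x y = z * lie_bracket u y + (lie_bracket z y * u + lie_bracket v y)"
      by (simp add: x lie_bracket_add_left lie_bracket_mult_left)
    moreover have "lie_bracket z y * u + lie_bracket v y \<in> J"
      using J z v by (blast intro: two_sided_ideal_closed two_sided_ideal_bracket)
    ultimately show "lie_bracket x y \<in> coset_mult z (lie_filtration (Suc (j + i))) J"
      using bracket_lie_filtration[OF u] coset_multI by metis
  qed
  then show ?case by simp
qed (use assms in simp)

lemma coset_mult_coset_mult_subset:
  assumes J: "two_sided_ideal J" and "Y \<subseteq> coset_mult w X J"
  shows "coset_mult z Y J \<subseteq> coset_mult (z * w) X J"
proof
  fix u assume "u \<in> coset_mult z Y J"
  then obtain y j where *: "y \<in> Y" "j \<in> J" "u = z * y + j" by (rule coset_multE)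
  then obtain x j' where **: "x \<in> X" "j' \<in> J" "y = w * x + j'" using assms by (meson coset_multE subsetD)
  have "u = (z * w) * x + (z * j' + j)" using * ** by (simp add: algebra_simps)
  moreover have "z * j' + j \<in> J" using * ** J by (blast intro: two_sided_ideal_closed)
  ultimately show "u \<in> coset_mult (z * w) X J" using ** coset_multI by metis
qed

lemma coset_mult_subset_ideal:
  assumes "two_sided_ideal J" "z \<in> J"
  shows "coset_mult z X J \<subseteq> J"
  using assms by (auto simp: coset_mult_def intro!: two_sided_ideal_closed)

text \<open>
  Each power of \<open>z\<close> costs \<open>k\<close> commutators: once \<open>z\<^sup>i\<close> has been split off, the cofactor is an
  arbitrary element of \<open>R = V 0\<close>, and the process starts again.
\<close>

lemma lie_filtration_lift_power:
  assumes J: "two_sided_ideal J" and z: "\<And>r. lie_bracket z r \<in> J"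
    and "lie_filtration k \<subseteq> coset_mult z UNIV J"
  shows "lie_filtration (k * i) \<subseteq> coset_mult (z ^ i) UNIV J"
proof (induction i)
  case 0
  then show ?case using subset_coset_mult[of UNIV J 1] coset_multI[of _ UNIV 0 J 1] two_sided_ideal_zero[OF J]
    by (auto simp: coset_mult_def)
next
  case (Suc i)
  have "lie_filtration (k + k * i) \<subseteq> coset_mult z (lie_filtration (0 + k * i)) J"
    by (rule lie_filtration_shift[OF J z]) (use assms(3) in simp)
  also have "\<dots> \<subseteq> coset_mult (z * z ^ i) UNIV J"
    by (rule coset_mult_coset_mult_subset[OF J]) (use Suc in simp)
  finally show ?case by simp
qed

lemma lie_filtration_lift:
  assumes J: "two_sided_ideal J" and z: "\<And>r. lie_bracket z r \<in> J"
    and "lie_filtration k \<subseteq> coset_mult z UNIV J" and "z ^ p \<in> J"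
  shows "lie_filtration (k * p) \<subseteq> J"
  using lie_filtration_lift_power[OF assms(1-3), of p] coset_mult_subset_ideal[OF J assms(4)] by blast

text \<open>
  If the step from \<open>1\<close> to \<open>z\<close> takes \<open>k\<close> commutators beyond the first one, then so does every
  further step from \<open>z\<^sup>i\<close> to \<open>z\<^sup>i\<^sup>+\<^sup>1\<close>, whence \<open>1 + p k\<close> commutators reach \<open>z\<^sup>p\<close>.  The plain lifting
  with \<open>k + 1\<close> in place of \<open>k\<close> only gives \<open>p + p k\<close>.
\<close>

lemma lie_filtration_lift_strong:
  assumes J: "two_sided_ideal J" and z: "\<And>r. lie_bracket z r \<in> J"
    and "lie_filtration (Suc k) \<subseteq> coset_mult z (lie_filtration 1) J" and "z ^ p \<in> J" and "0 < p"
  shows "lie_filtration (Suc (p * k)) \<subseteq> J"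
proof -
  have "lie_filtration (Suc (Suc i * k)) \<subseteq> coset_mult (z ^ Suc i) (lie_filtration 1) J" for i
  proof (induction i)
    case 0
    show ?case using assms(3) by simp
  next
    case (Suc i)
    have "lie_filtration (Suc k + Suc i * k) \<subseteq> coset_mult z (lie_filtration (1 + Suc i * k)) J"
      by (rule lie_filtration_shift[OF J z assms(3)])
    also have "\<dots> \<subseteq> coset_mult (z * z ^ Suc i) (lie_filtration 1) J"
      by (rule coset_mult_coset_mult_subset[OF J]) (use Suc in simp)
    finally show ?case by simp
  qed
  from this[of "p - 1"] show ?thesis
    using coset_mult_subset_ideal[OF J assms(4)] \<open>0 < p\<close> by auto
qed

lemma foldl_bracket_in_lie_filtration: "foldl lie_bracket x xs \<in> lie_filtration (length xs)"
proof (induction xs rule: rev_induct)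
  case (snoc y ys)
  then show ?case using bracket_lie_filtration by fastforce
qed simp

lemma lower_subset_upper_lie_power: "lower_lie_power (Suc k) \<subseteq> lie_filtration k"
  unfolding lower_lie_power_def
  using foldl_bracket_in_lie_filtration two_sided_ideal_upper_lie_power
  by (intro hull_minimal) auto

section \<open>The Frobenius map in a noncommutative ring\<close>

text \<open>
  The powers of a single element commute, so the binomial theorem and the Frobenius identity
  need no commutativity of the ring.
\<close>

lemma add_one_power_expand:
  fixes v :: "'a::ring_1"
  shows "(v + 1) ^ n = (\<Sum>k\<le>n. of_nat (n choose k) * v ^ k)"
proof (induction n)
  case (Suc n)
  have comm: "v * (of_nat m * v ^ k) = of_nat m * v ^ Suc k" for m k
    by (metis mult.assoc mult_of_nat_commute power_Suc)
  have "(v + 1) ^ Suc n = v * (\<Sum>k\<le>n. of_nat (n choose k) * v ^ k) + (\<Sum>k\<le>n. of_nat (n choose k) * v ^ k)"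
    by (simp add: Suc distrib_right)
  also have "v * (\<Sum>k\<le>n. of_nat (n choose k) * v ^ k) = (\<Sum>k\<le>n. of_nat (n choose k) * v ^ Suc k)"
    by (simp only: sum_distrib_left comm)
  also have "(\<Sum>k\<le>n. of_nat (n choose k) * v ^ k) = 1 + (\<Sum>k\<le>n. of_nat (n choose Suc k) * v ^ Suc k)"
  proof -
    have "(\<Sum>k\<le>n. of_nat (n choose k) * v ^ k) = (\<Sum>k\<le>Suc n. of_nat (n choose k) * v ^ k)"
      by (simp add: binomial_eq_0)
    also have "\<dots> = 1 + (\<Sum>k\<le>n. of_nat (n choose Suc k) * v ^ Suc k)"
      by (subst sum.atMost_Suc_shift) simp
    finally show ?thesis .
  qed
  finally have "(v + 1) ^ Suc n = 1 + (\<Sum>k\<le>n. of_nat (Suc n choose Suc k) * v ^ Suc k)"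
    by (simp add: sum.distrib distrib_right add_ac)
  also have "\<dots> = (\<Sum>k\<le>Suc n. of_nat (Suc n choose k) * v ^ k)"
    by (subst sum.atMost_Suc_shift) simp
  finally show ?case .
qed simp

lemma diff_one_power_prime:
  fixes u :: "'a::ring_1"
  assumes "prime p" "of_nat p = (0::'a)"
  shows "(u - 1) ^ p = u ^ p - 1"
proof -
  have p: "0 < p" using assms(1) by (simp add: prime_gt_0_nat)
  have "u ^ p = (\<Sum>k\<le>p. of_nat (p choose k) * (u - 1) ^ k)"
    using add_one_power_expand[of "u - 1" p] by simp
  also have "\<dots> = (\<Sum>k\<in>{0, p}. of_nat (p choose k) * (u - 1) ^ k)"
  proof (rule sum.mono_neutral_right)
    show "\<forall>k\<in>{..p} - {0, p}. of_nat (p choose k) * (u - 1) ^ k = 0"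
    proof
      fix k assume "k \<in> {..p} - {0, p}"
      then have "p dvd p choose k"
        using assms(1) by (intro dvd_choose_prime) auto
      then obtain m where "p choose k = p * m" by blast
      then show "of_nat (p choose k) * (u - 1) ^ k = 0" using assms(2) by simp
    qed
  qed auto
  also have "\<dots> = 1 + (u - 1) ^ p" using p by simp
  finally show ?thesis by simp
qed

lemma diff_one_power_prime_power:
  fixes u :: "'a::ring_1"
  assumes "prime p" "of_nat p = (0::'a)"
  shows "(u - 1) ^ (p ^ e) = u ^ (p ^ e) - 1"
proof (induction e)
  case (Suc e)
  have "(u - 1) ^ (p ^ Suc e) = ((u - 1) ^ (p ^ e)) ^ p"
    by (simp add: power_mult[symmetric] mult.commute)
  also have "\<dots> = (u ^ (p ^ e)) ^ p - 1"
    using diff_one_power_prime[OF assms, of "u ^ (p ^ e)"] by (simp add: Suc)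
  also have "\<dots> = u ^ (p ^ Suc e) - 1"
    by (simp add: power_mult[symmetric] mult.commute)
  finally show ?case .
qed simp

section \<open>Normal subgroups in additive notation\<close>

lemma subgroup_add_zero: "subgroup_add H \<Longrightarrow> 0 \<in> H"
  and subgroup_add_add: "subgroup_add H \<Longrightarrow> x \<in> H \<Longrightarrow> y \<in> H \<Longrightarrow> x + y \<in> H"
  and subgroup_add_uminus: "subgroup_add H \<Longrightarrow> x \<in> H \<Longrightarrow> - x \<in> H"
  by (auto simp: subgroup_add_def)

lemmas subgroup_add_closed = subgroup_add_zero subgroup_add_add subgroup_add_uminus

lemma subgroup_add_hull: "subgroup_add (subgroup_add hull S)"
  by (rule hull_in) (auto simp: subgroup_add_def)

lemmas group_add_normalize =
  add.assoc minus_add minus_minus minus_zero add_0_left add_0_right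
  left_minus right_minus minus_add_cancel add_minus_cancel

lemma subgroup_add_cancel_left:
  assumes "subgroup_add H" "x \<in> H"
  shows "x + y \<in> H \<longleftrightarrow> y \<in> H"
  by (metis assms minus_add_cancel subgroup_add_add subgroup_add_uminus)

lemma subgroup_add_cancel_right:
  assumes "subgroup_add H" "y \<in> H"
  shows "x + y \<in> H \<longleftrightarrow> x \<in> H"
proof -
  have "x = (x + y) + - y" by (simp only: group_add_normalize)
  then show ?thesis using assms by (metis subgroup_add_add subgroup_add_uminus)
qed

definition normal_subgroup_add :: "'g::group_add set \<Rightarrow> bool" where
  "normal_subgroup_add N \<longleftrightarrow> subgroup_add N \<and> (\<forall>h\<in>N. \<forall>g. - g + h + g \<in> N)"

definition group_comm :: "'g::group_add \<Rightarrow> 'g \<Rightarrow> 'g" where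
  "group_comm x y = - x + - y + x + y"

lemma normal_subgroup_addD: "normal_subgroup_add N \<Longrightarrow> subgroup_add N"
  by (simp add: normal_subgroup_add_def)

lemma normal_subgroup_add_conj: "normal_subgroup_add N \<Longrightarrow> h \<in> N \<Longrightarrow> - g + h + g \<in> N"
  by (simp add: normal_subgroup_add_def)

lemma group_comm_eq: "group_comm h g = - h + (- g + h + g)"
  by (simp only: group_comm_def group_add_normalize)

lemma conj_eq_group_comm: "- g + h + g = h + group_comm h g"
  by (simp only: group_comm_def group_add_normalize)

lemma add_group_comm: "g + h + group_comm h g = h + g"
  by (simp only: group_comm_def group_add_normalize)

lemma group_comm_in_normal: "normal_subgroup_add N \<Longrightarrow> h \<in> N \<Longrightarrow> group_comm h g \<in> N"
  unfolding group_comm_eq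
  by (intro subgroup_add_add subgroup_add_uminus normal_subgroup_addD normal_subgroup_add_conj)

lemma group_comm_add_left: "group_comm (x + y) g = - y + group_comm x g + y + group_comm y g"
  by (simp only: group_comm_def group_add_normalize)

lemma group_comm_uminus_left: "group_comm (- x) g = x + - group_comm x g + - x"
  by (simp only: group_comm_def group_add_normalize)

lemma group_comm_add_right: "group_comm x (g + h) = group_comm x h + (- h + group_comm x g + h)"
  by (simp only: group_comm_def group_add_normalize)

lemma group_comm_swap: "group_comm y x = - group_comm x y"
  by (simp only: group_comm_def group_add_normalize)

lemma group_comm_self [simp]: "group_comm x x = 0"
  by (simp only: group_comm_def group_add_normalize)

lemma group_comm_zero_left [simp]: "group_comm 0 x = 0"
  by (simp only: group_comm_def group_add_normalize)

lemma commutator_subgroup_alt: "commutator_subgroup = subgroup_add hull {group_comm x y | x y. True}"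
  by (simp add: commutator_subgroup_def group_comm_def)

lemma subgroup_commutator_subgroup: "subgroup_add commutator_subgroup"
  by (simp add: commutator_subgroup_def subgroup_add_hull)

lemma group_comm_in_commutator_subgroup: "group_comm x y \<in> commutator_subgroup"
  by (auto simp: commutator_subgroup_alt intro: hull_inc)

lemma commutator_subgroup_least:
  assumes "subgroup_add H" "\<And>x y. group_comm x y \<in> H"
  shows "commutator_subgroup \<subseteq> H"
  unfolding commutator_subgroup_alt using assms by (intro hull_minimal) auto

lemma normal_commutator_subgroup: "normal_subgroup_add commutator_subgroup"
  by (auto simp: normal_subgroup_add_def subgroup_commutator_subgroup conj_eq_group_comm
      intro: subgroup_add_add[OF subgroup_commutator_subgroup] group_comm_in_commutator_subgroup)

lemma normal_subgroup_add_singleton: "normal_subgroup_add {0}"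
  by (simp add: normal_subgroup_add_def subgroup_add_def)

lemma subgroup_central_mod:
  assumes "normal_subgroup_add L"
  shows "subgroup_add {h. \<forall>g. group_comm h g \<in> L}"
  unfolding subgroup_add_def
proof (intro conjI ballI)
  have L: "subgroup_add L" using assms by (rule normal_subgroup_addD)
  show "0 \<in> {h. \<forall>g. group_comm h g \<in> L}" using subgroup_add_zero[OF L] by simp
  fix x assume x: "x \<in> {h. \<forall>g. group_comm h g \<in> L}"
  have "x + - group_comm x g + - x \<in> L" for g
    using normal_subgroup_add_conj[OF assms, of "- group_comm x g" "- x"] x subgroup_add_uminus[OF L] by simp
  then show "- x \<in> {h. \<forall>g. group_comm h g \<in> L}" by (simp add: group_comm_uminus_left)
  fix y assume y: "y \<in> {h. \<forall>g. group_comm h g \<in> L}"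
  have "- y + group_comm x g + y + group_comm y g \<in> L" for g
    using normal_subgroup_add_conj[OF assms] x y subgroup_add_add[OF L] by simp
  then show "x + y \<in> {h. \<forall>g. group_comm h g \<in> L}" by (simp add: group_comm_add_left)
qed

lemma group_comm_hull_insert:
  assumes L: "normal_subgroup_add L" and z: "\<And>g. group_comm z g \<in> L"
    and "h \<in> subgroup_add hull (insert z L)"
  shows "group_comm h g \<in> L"
proof -
  have "subgroup_add hull (insert z L) \<subseteq> {h. \<forall>g. group_comm h g \<in> L}"
    using z group_comm_in_normal[OF L] by (intro hull_minimal subgroup_central_mod[OF L]) auto
  then show ?thesis using assms(3) by blast
qed

lemma normal_hull_insert:
  assumes L: "normal_subgroup_add L" and z: "\<And>g. group_comm z g \<in> L"
  shows "normal_subgroup_add (subgroup_add hull (insert z L))"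
  unfolding normal_subgroup_add_def conj_eq_group_comm
proof (intro conjI ballI allI)
  fix h g assume h: "h \<in> subgroup_add hull (insert z L)"
  have "group_comm h g \<in> subgroup_add hull (insert z L)"
    using group_comm_hull_insert[OF L z h] by (auto intro: hull_inc)
  then show "h + group_comm h g \<in> subgroup_add hull (insert z L)"
    using h subgroup_add_hull subgroup_add_add by blast
qed (rule subgroup_add_hull)

subsection \<open>Multiples of a group element\<close>

primrec nmul :: "nat \<Rightarrow> 'g::group_add \<Rightarrow> 'g" where
  "nmul 0 g = 0"
| "nmul (Suc k) g = g + nmul k g"

lemma nmul_add: "nmul (i + j) g = nmul i g + nmul j g"
  by (induction i) (simp_all add: add.assoc)

lemma nmul_commute: "nmul i g + nmul j g = nmul j g + nmul i g"
  by (metis add.commute nmul_add)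

lemma nmul_mult: "nmul (i * j) g = nmul i (nmul j g)"
  by (induction i) (simp_all add: nmul_add)

lemma nmul_mult': "nmul (i * j) g = nmul j (nmul i g)"
  by (metis mult.commute nmul_mult)

lemma nmul_one [simp]: "nmul 1 g = g" "nmul (Suc 0) g = g"
  by simp_all

lemma nmul_conj: "- g + nmul k h + g = nmul k (- g + h + g)"
proof (induction k)
  case (Suc k)
  have "- g + nmul (Suc k) h + g = (- g + h + g) + (- g + nmul k h + g)" by (simp add: add.assoc)
  then show ?case by (simp add: Suc)
qed simp

lemma nmul_closed: "subgroup_add H \<Longrightarrow> g \<in> H \<Longrightarrow> nmul k g \<in> H"
  by (induction k) (auto intro: subgroup_add_closed)

lemma nmul_coprime_in:
  assumes H: "subgroup_add H" and "nmul a g \<in> H" "nmul b g \<in> H" "coprime a b" "a \<noteq> 0"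
  shows "g \<in> H"
proof -
  obtain x y where "a * x = b * y + 1"
    using bezout_nat[of a b] assms(4,5) by (auto simp: coprime_iff_gcd_eq_1)
  then have "nmul (a * x) g = nmul (b * y) g + g"
    using nmul_add[of "b * y" 1 g] by simp
  moreover have "nmul (a * x) g \<in> H" "nmul (b * y) g \<in> H"
    using assms nmul_closed[OF H] by (simp_all add: nmul_mult')
  ultimately show ?thesis using subgroup_add_cancel_left[OF H] by metis
qed

text \<open>
  Normality of \<open>L\<close> lets every word in \<open>z\<close> and elements of \<open>L\<close> be sorted into a multiple of \<open>z\<close>
  followed by an element of \<open>L\<close>, and \<open>nmul p z \<in> L\<close> makes negative multiples of \<open>z\<close>
  superfluous.
\<close>

lemma hull_insert_eq_nmul:
  assumes L: "normal_subgroup_add L" and p: "0 < p" and pz: "nmul p z \<in> L"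
  shows "subgroup_add hull (insert z L) = (\<lambda>(i, l). nmul i z + l) ` ({..<p} \<times> L)"
proof
  have sL: "subgroup_add L" using L by (rule normal_subgroup_addD)
  let ?H = "subgroup_add hull (insert z L)"
  have H: "subgroup_add ?H" by (rule subgroup_add_hull)
  have "z \<in> ?H" "L \<subseteq> ?H" by (auto intro: hull_inc)
  then show "(\<lambda>(i, l). nmul i z + l) ` ({..<p} \<times> L) \<subseteq> ?H"
    using nmul_closed[OF H] subgroup_add_add[OF H] by auto
  let ?T = "{nmul i z + l | i l. l \<in> L}"
  have conj: "- k + l + k \<in> L" if "l \<in> L" for k l
    using normal_subgroup_add_conj[OF L that] .
  have "subgroup_add ?T"
    unfolding subgroup_add_def
  proof (intro conjI ballI)
    show "0 \<in> ?T" using subgroup_add_zero[OF sL] by (auto intro!: exI[of _ 0])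
    fix x assume "x \<in> ?T"
    then obtain i l where x: "x = nmul i z + l" "l \<in> L" by blast
    {
      fix y assume "y \<in> ?T"
      then obtain j m where y: "y = nmul j z + m" "m \<in> L" by blast
      have "x + y = nmul (i + j) z + ((- nmul j z + l + nmul j z) + m)"
        by (simp add: x y nmul_add add.assoc)
      moreover have "(- nmul j z + l + nmul j z) + m \<in> L"
        using x y conj subgroup_add_add[OF sL] by blast
      ultimately show "x + y \<in> ?T" by blast
    }
    have "i + i * (p - 1) = i * p" using p by (cases p) simp_all
    then have "nmul (i * p) z = nmul i z + nmul (i * (p - 1)) z" by (metis nmul_add)
    then have "- nmul i z = nmul (i * (p - 1)) z + - nmul (i * p) z"
      by (simp only: group_add_normalize)
    then have "- x = nmul (i * (p - 1)) z + (- (- nmul (i * (p - 1)) z + l + nmul (i * (p - 1)) z) + - nmul (i * p) z)"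
      by (simp only: x group_add_normalize)
    moreover have "nmul (i * p) z \<in> L"
      using nmul_closed[OF sL pz, of i] by (simp add: nmul_mult)
    then have "- (- nmul (i * (p - 1)) z + l + nmul (i * (p - 1)) z) + - nmul (i * p) z \<in> L"
      using x conj sL by (blast intro: subgroup_add_closed)
    ultimately show "- x \<in> ?T" by blast
  qed
  moreover have "insert z L \<subseteq> ?T"
  proof -
    have "z = nmul 1 z + 0" by simp
    then have "z \<in> ?T" using subgroup_add_zero[OF sL] by blast
    moreover have "l = nmul 0 z + l" for l by simp
    then have "L \<subseteq> ?T" by blast
    ultimately show ?thesis by blast
  qed
  ultimately have "?H \<subseteq> ?T" by (intro hull_minimal)
  also have "?T \<subseteq> (\<lambda>(i, l). nmul i z + l) ` ({..<p} \<times> L)"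
  proof clarify
    fix i l assume l: "l \<in> L"
    have "nmul i z = nmul (i mod p) z + nmul (i div p * p) z"
      by (simp flip: nmul_add)
    then have "nmul i z + l = nmul (i mod p) z + (nmul (i div p * p) z + l)" by (simp add: add.assoc)
    moreover have "nmul (i div p * p) z + l \<in> L"
      using nmul_closed[OF sL pz, of "i div p"] l sL by (auto simp only: nmul_mult intro: subgroup_add_closed)
    ultimately show "nmul i z + l \<in> (\<lambda>(i, l). nmul i z + l) ` ({..<p} \<times> L)"
      using p by (intro image_eqI[of _ _ "(i mod p, nmul (i div p * p) z + l)"]) auto
  qed
  finally show "?H \<subseteq> (\<lambda>(i, l). nmul i z + l) ` ({..<p} \<times> L)" .
qed

lemma hull_singleton_eq_nmul:
  assumes "0 < k" "nmul k c = 0"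
  shows "subgroup_add hull {c} = (\<lambda>i. nmul i c) ` {..<k}"
proof -
  have "subgroup_add hull {c} = subgroup_add hull (insert c {0})"
    using hull_redundant[of 0 subgroup_add "{c}"] subgroup_add_zero[OF subgroup_add_hull, of "{c}"]
    by (simp add: insert_commute)
  also have "\<dots> = (\<lambda>(i, l). nmul i c + l) ` ({..<k} \<times> {0})"
    using assms by (intro hull_insert_eq_nmul normal_subgroup_add_singleton) auto
  also have "\<dots> = (\<lambda>i. nmul i c) ` {..<k}" by force
  finally show ?thesis .
qed

lemma card_hull_insert:
  assumes L: "normal_subgroup_add L" and p: "prime p" and pz: "nmul p z \<in> L" and z: "z \<notin> L"
  shows "card (subgroup_add hull (insert z L)) = p * card L"
proof -
  have sL: "subgroup_add L" using L by (rule normal_subgroup_addD)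
  have p0: "0 < p" using p by (simp add: prime_gt_0_nat)
  have *: "i = j" if "i \<le> j" "j < p" "nmul i z + l = nmul j z + m" "l \<in> L" "m \<in> L" for i j l m
  proof (rule ccontr)
    assume "i \<noteq> j"
    define d where "d = j - i"
    have d: "0 < d" "d < p" "j = i + d" using that \<open>i \<noteq> j\<close> by (auto simp: d_def)
    have "l = nmul d z + m" using that(3) by (simp add: d(3) nmul_add add.assoc)
    then have "nmul d z \<in> L" using that subgroup_add_cancel_right[OF sL] by metis
    moreover have "coprime d p"
      using d p by (metis coprime_commute nat_dvd_not_less prime_imp_coprime)
    ultimately show False using nmul_coprime_in[OF sL _ pz] d z by blast
  qed
  have "inj_on (\<lambda>(i, l). nmul i z + l) ({..<p} \<times> L)"
  proof (rule inj_onI, clarsimp)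
    fix i j l m assume a: "i < p" "l \<in> L" "j < p" "m \<in> L" and e: "nmul i z + l = nmul j z + m"
    have "i = j" using *[of i j l m] *[of j i m l] a e by (metis nle_le)
    then show "i = j \<and> l = m" using e by simp
  qed
  then show ?thesis
    by (simp add: hull_insert_eq_nmul[OF L p0 pz] card_image card_cartesian_product)
qed

section \<open>Augmentation ideals of the group algebra\<close>

text \<open>
  A right ideal contains a two-sided ideal as soon as it contains all left multiples of the
  generators.  This is used for the right ideals \<open>x R + J\<close> with \<open>x\<close> not central modulo \<open>J\<close>.
\<close>

lemma two_sided_ideal_hull_subset_right_ideal:
  assumes "\<And>x y. x \<in> X \<Longrightarrow> y \<in> X \<Longrightarrow> x + y \<in> X" "\<And>x r. x \<in> X \<Longrightarrow> x * r \<in> X"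
    and "0 \<in> X" and S: "\<And>w r. w \<in> S \<Longrightarrow> r * w \<in> X"
  shows "two_sided_ideal hull S \<subseteq> X"
proof -
  have "two_sided_ideal {w. \<forall>r. r * w \<in> X}"
    using assms by (auto simp: two_sided_ideal_def distrib_left simp flip: mult.assoc)
  then have "two_sided_ideal hull S \<subseteq> {w. \<forall>r. r * w \<in> X}"
    using S by (intro hull_minimal) auto
  then have "1 * w \<in> X" if "w \<in> two_sided_ideal hull S" for w
    using that by blast
  then show ?thesis by auto
qed

text \<open>
  The embedding \<open>delta\<close> of the group into its group algebra is a parameter because it ties the type
  of coefficients to that of group elements; otherwise every statement about group elements alone
  would leave the field undetermined.
\<close>

locale modular_group_algebra =
  fixes p :: nat and delta :: "'g::group_add \<Rightarrow> ('g, 'k::field) group_algebra"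
  assumes delta_def: "delta = (\<lambda>g. Poly_Mapping.single g 1)"
    and prime_p: "prime p" and char_p: "of_nat p = (0::'k)"
begin

abbreviation G' :: "'g set" where "G' \<equiv> commutator_subgroup"

abbreviation V :: "nat \<Rightarrow> ('g, 'k) group_algebra set" where "V \<equiv> lie_filtration"

lemma ideal_V: "two_sided_ideal (V k)"
  by (rule two_sided_ideal_upper_lie_power)

lemma V_antimono: "i \<le> j \<Longrightarrow> V j \<subseteq> V i"
  by (rule lie_filtration_antimono)

lemma delta_add: "delta (g + h) = delta g * delta h"
  by (simp add: delta_def mult_single)

lemma delta_zero [simp]: "delta 0 = 1"
  by (simp add: delta_def)

lemma delta_inverse: "delta (- g) * delta g = 1" "delta g * delta (- g) = 1"
  by (simp_all flip: delta_add)

lemma delta_inverse_cancel: "delta (- g) * (delta g * r) = r" "delta g * (delta (- g) * r) = r"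
  by (simp_all add: delta_inverse flip: mult.assoc)

lemma delta_nmul: "delta (nmul k g) = delta g ^ k"
  by (induction k) (simp_all add: delta_add)

lemma lookup_delta: "Poly_Mapping.lookup (delta g) h = (if h = g then 1 else 0)"
  by (auto simp: delta_def lookup_single when_def)

lemma delta_eq_iff [simp]: "delta g = delta h \<longleftrightarrow> g = h"
  by (metis lookup_delta one_neq_zero)

lemma of_nat_p: "of_nat p = (0 :: ('g, 'k) group_algebra)"
  using char_p by (metis single_of_nat single_zero)

lemma delta_diff_one_power: "(delta g - 1) ^ (p ^ e) = delta (nmul (p ^ e) g) - 1"
  by (simp add: diff_one_power_prime_power[OF prime_p of_nat_p] delta_nmul)

lemma delta_diff_one_power_p: "(delta g - 1) ^ p = delta (nmul p g) - 1"
  using delta_diff_one_power[of g 1] by simp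

lemma group_algebra_induct [case_names zero add single]:
  assumes "P 0" "\<And>r s. P r \<Longrightarrow> P s \<Longrightarrow> P (r + s)" "\<And>c g. P (Poly_Mapping.single 0 c * delta g)"
  shows "P (r :: ('g, 'k) group_algebra)"
proof -
  have "(\<Sum>g\<in>Poly_Mapping.keys r. Poly_Mapping.single 0 (Poly_Mapping.lookup r g) * delta g) = r"
    by (rule poly_mapping_eqI)
      (auto simp: lookup_sum delta_def mult_single lookup_single when_def in_keys_iff)
  moreover have "P (\<Sum>g\<in>A. Poly_Mapping.single 0 (Poly_Mapping.lookup r g) * delta g)" if "finite A" for A
    using that by (induction A) (simp_all add: assms)
  ultimately show ?thesis using finite_keys[of r] by metis
qed

lemma scalar_commute: "Poly_Mapping.single 0 c * r = r * Poly_Mapping.single 0 (c::'k)"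
  for r :: "('g, 'k) group_algebra"
  by (induction r rule: group_algebra_induct)
    (simp_all add: distrib_left distrib_right delta_def mult_single mult.commute)

lemma lookup_delta_mult: "Poly_Mapping.lookup (delta a * r) g = Poly_Mapping.lookup r (- a + g)"
proof (induction r rule: group_algebra_induct)
  case (single c h)
  have "a + h = g \<longleftrightarrow> h = - a + g" by (metis add_minus_cancel minus_add_cancel)
  then show ?case by (simp add: delta_def mult_single lookup_single)
qed (simp_all add: distrib_left lookup_add)

lemma bracket_in_ideal:
  assumes J: "two_sided_ideal J" and "\<And>g. lie_bracket x (delta g) \<in> J"
  shows "lie_bracket x r \<in> J"
proof (induction r rule: group_algebra_induct)
  case (single c g)
  have "lie_bracket x (Poly_Mapping.single 0 c * delta g) = Poly_Mapping.single 0 c * lie_bracket x (delta g)"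
    by (simp add: lie_bracket_def right_diff_distrib scalar_commute flip: mult.assoc)
      (simp add: scalar_commute mult.assoc)
  then show ?case using assms by (simp add: two_sided_ideal_mult_left)
qed (simp_all add: lie_bracket_add_right J two_sided_ideal_closed)

text \<open>
  A ring commutator of group elements is a unit times \<open>c - 1\<close>, where \<open>c\<close> is their group commutator.
  This identity translates between centrality modulo a subgroup and centrality modulo an ideal.
\<close>

lemma bracket_delta: "lie_bracket (delta h) (delta g) = delta g * delta h * (delta (group_comm h g) - 1)"
proof -
  have "delta g * delta h * delta (group_comm h g) = delta h * delta g"
    by (simp only: add_group_comm flip: delta_add)
  then show ?thesis by (simp add: lie_bracket_def right_diff_distrib)
qed

text \<open>
  Both closure properties come from writing \<open>h k - 1 = (h - 1) k + (k - 1)\<close> and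
  \<open>h\<^sup>-\<^sup>1 - 1 = (h - 1) (- h\<^sup>-\<^sup>1)\<close>, which only multiply by group elements from the right.
\<close>

lemma subgroup_of_right_ideal:
  assumes "\<And>x y. x \<in> X \<Longrightarrow> y \<in> X \<Longrightarrow> x + y \<in> X" "\<And>x r. x \<in> X \<Longrightarrow> x * r \<in> X" "0 \<in> X"
  shows "subgroup_add {h. delta h - 1 \<in> X}"
  unfolding subgroup_add_def
proof (intro conjI ballI)
  show "0 \<in> {h. delta h - 1 \<in> X}" using assms(3) by simp
  fix h assume h: "h \<in> {h. delta h - 1 \<in> X}"
  have "delta (- h) - 1 = (delta h - 1) * (- delta (- h))"
    by (simp add: delta_inverse left_diff_distrib)
  moreover have "(delta h - 1) * (- delta (- h)) \<in> X" using h assms(2) by blast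
  ultimately show "- h \<in> {h. delta h - 1 \<in> X}" by simp
  fix k assume k: "k \<in> {h. delta h - 1 \<in> X}"
  have "delta (h + k) - 1 = (delta h - 1) * delta k + (delta k - 1)"
    by (simp add: delta_add left_diff_distrib)
  moreover have "(delta h - 1) * delta k + (delta k - 1) \<in> X" using h k assms(1,2) by blast
  ultimately show "h + k \<in> {h. delta h - 1 \<in> X}" by (simp only: mem_Collect_eq)
qed

lemma normal_subgroup_of_ideal:
  assumes I: "two_sided_ideal I"
  shows "normal_subgroup_add {h. delta h - 1 \<in> I}"
  unfolding normal_subgroup_add_def
proof (intro conjI ballI allI)
  show "subgroup_add {h. delta h - 1 \<in> I}"
    by (rule subgroup_of_right_ideal) (use I two_sided_ideal_closed in blast)+
  fix h g assume "h \<in> {h. delta h - 1 \<in> I}"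
  then have "delta (- g) * (delta h - 1) * delta g \<in> I"
    using I by (simp add: two_sided_ideal_closed)
  moreover have "delta (- g) * (delta h - 1) * delta g = delta (- g + h + g) - 1"
    by (simp add: delta_add delta_inverse algebra_simps)
  ultimately show "- g + h + g \<in> {h. delta h - 1 \<in> I}" by simp
qed

lemma group_comm_in_ideal:
  assumes I: "two_sided_ideal I" and "lie_bracket (delta h) (delta g) \<in> I"
  shows "delta (group_comm h g) - 1 \<in> I"
proof -
  have "delta (- h) * (delta (- g) * lie_bracket (delta h) (delta g)) \<in> I"
    using assms by (simp add: two_sided_ideal_closed)
  then show ?thesis by (simp add: bracket_delta delta_inverse_cancel mult.assoc)
qed

definition aug_ideal :: "'g set \<Rightarrow> ('g, 'k) group_algebra set" where
  "aug_ideal N = two_sided_ideal hull ((\<lambda>h. delta h - 1) ` N)"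

lemma ideal_aug: "two_sided_ideal (aug_ideal N)"
  by (simp add: aug_ideal_def two_sided_ideal_hull)

lemma aug_idealI: "h \<in> N \<Longrightarrow> delta h - 1 \<in> aug_ideal N"
  by (auto simp: aug_ideal_def intro: hull_inc)

lemma aug_ideal_least:
  "two_sided_ideal I \<Longrightarrow> (\<And>h. h \<in> N \<Longrightarrow> delta h - 1 \<in> I) \<Longrightarrow> aug_ideal N \<subseteq> I"
  unfolding aug_ideal_def by (intro hull_minimal) auto

lemma aug_ideal_mono: "M \<subseteq> N \<Longrightarrow> aug_ideal M \<subseteq> aug_ideal N"
  by (rule aug_ideal_least) (auto intro: ideal_aug aug_idealI)

lemma aug_ideal_zero: "aug_ideal {0} = {0}"
  using aug_ideal_least[of "{0}" "{0}"] ideal_aug[of "{0}"]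
  by (auto simp: two_sided_ideal_singleton_zero two_sided_ideal_zero)

lemma bracket_in_aug_ideal:
  assumes "\<And>g. group_comm h g \<in> L"
  shows "lie_bracket (delta h - 1) r \<in> aug_ideal L"
proof (rule bracket_in_ideal[OF ideal_aug])
  fix g
  have "lie_bracket (delta h) (delta g) \<in> aug_ideal L"
    using assms by (auto simp: bracket_delta intro: two_sided_ideal_mult_left[OF ideal_aug] aug_idealI)
  then show "lie_bracket (delta h - 1) (delta g) \<in> aug_ideal L"
    by (simp add: lie_bracket_diff_left)
qed

lemma aug_ideal_hull_insert:
  assumes z: "\<And>g. group_comm z g \<in> L"
  shows "aug_ideal (subgroup_add hull (insert z L)) \<subseteq> coset_mult (delta z - 1) UNIV (aug_ideal L)"
    (is "_ \<subseteq> ?I")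
proof (rule aug_ideal_least)
  show I: "two_sided_ideal ?I"
    by (intro two_sided_ideal_coset_mult ideal_aug two_sided_ideal_UNIV bracket_in_aug_ideal z)
  have "aug_ideal L \<subseteq> ?I" by (rule subset_coset_mult) simp
  moreover have "delta z - 1 \<in> ?I"
    using mult_in_coset_mult[OF ideal_aug, of 1 UNIV "delta z - 1" L] by simp
  ultimately have "subgroup_add hull (insert z L) \<subseteq> {h. delta h - 1 \<in> ?I}"
    using aug_idealI by (intro hull_minimal normal_subgroup_addD normal_subgroup_of_ideal I) auto
  then show "delta h - 1 \<in> ?I" if "h \<in> subgroup_add hull (insert z L)" for h using that by blast
qed

lemma V_1_eq: "V 1 = aug_ideal G'"
proof
  have "lie_bracket x y \<in> aug_ideal G'" for x y
  proof (rule bracket_in_ideal[OF ideal_aug])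
    fix g
    have "lie_bracket (delta g) x \<in> aug_ideal G'"
      using bracket_in_aug_ideal[of g G' x] by (simp add: lie_bracket_diff_left group_comm_in_commutator_subgroup)
    then show "lie_bracket x (delta g) \<in> aug_ideal G'"
      using two_sided_ideal_uminus[OF ideal_aug] by (fastforce simp: lie_bracket_def)
  qed
  then show "V 1 \<subseteq> aug_ideal G'"
    using lie_filtration_Suc_least[OF ideal_aug, of 0 G'] by simp
  have "delta (group_comm x y) - 1 \<in> V 1" for x y
    using bracket_lie_filtration[of "delta x" 0 "delta y"] by (intro group_comm_in_ideal ideal_V) auto
  then have "G' \<subseteq> {h. delta h - 1 \<in> V 1}"
    by (intro commutator_subgroup_least normal_subgroup_addD normal_subgroup_of_ideal ideal_V) auto
  then show "aug_ideal G' \<subseteq> V 1"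
    by (intro aug_ideal_least ideal_V) blast
qed

lemma delta_in_V_1: "h \<in> G' \<Longrightarrow> delta h - 1 \<in> V 1"
  unfolding V_1_eq by (rule aug_idealI)

end

section \<open>Chief series inside the commutator subgroup\<close>

locale lie_nilpotent_group_algebra = modular_group_algebra p delta
  for p :: nat and delta :: "'g::group_add \<Rightarrow> ('g, 'k::field) group_algebra" +
  fixes n :: nat
  assumes finite_G': "finite G'" and V_n: "V n = {0}"
begin

text \<open>
  The element \<open>h - 1\<close> is nilpotent, and by the Frobenius identity its power with exponent \<open>p\<^sup>e\<close> is
  the difference of a power of \<open>h\<close> and \<open>1\<close>.
\<close>

lemma ex_p_power_multiple_zero:
  assumes "h \<in> G'"
  obtains e where "nmul (p ^ e) h = 0"
proof
  have "n \<le> p ^ n" using prime_p by (intro less_imp_le power_gt_expt) (auto simp: prime_gt_Suc_0_nat)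
  then have "(delta h - 1) ^ (p ^ n) \<in> V n"
    using lie_filtration_power[OF delta_in_V_1[OF assms]] V_antimono by blast
  then have "delta (nmul (p ^ n) h) = delta 0"
    using V_n by (simp add: delta_diff_one_power)
  then show "nmul (p ^ n) h = 0" by (simp only: delta_eq_iff)
qed

text \<open>
  The dimension subgroups \<open>D k = {h. h - 1 \<in> V k}\<close> satisfy \<open>(D k, G) \<subseteq> D (k + 1)\<close> and are
  eventually trivial.  An element of \<open>N - L\<close> lying in \<open>D k\<close> for the largest possible \<open>k\<close> is
  therefore central modulo \<open>L\<close>, and so are its multiples; the last of its \<open>p\<close>-power multiples
  outside \<open>L\<close> has the required order.
\<close>

lemma ex_central_element:
  assumes L: "normal_subgroup_add L" and N: "normal_subgroup_add N" and "L \<subset> N" "N \<subseteq> G'"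
  obtains z where "z \<in> N" "z \<notin> L" "\<And>g. group_comm z g \<in> L" "nmul p z \<in> L"
proof -
  have sL: "subgroup_add L" and sN: "subgroup_add N" using L N by (auto dest: normal_subgroup_addD)
  define D where "D k = {h. delta h - 1 \<in> V k}" for k
  have D: "normal_subgroup_add (D k)" for k
    unfolding D_def by (rule normal_subgroup_of_ideal[OF ideal_V])
  define K where "K = {k. \<exists>h\<in>N - L. h \<in> D k}"
  have "k < n" if "k \<in> K" for k
  proof (rule ccontr)
    assume "\<not> k < n"
    then have "V k \<subseteq> {0}" using V_antimono[of n k] V_n by simp
    moreover obtain h where "h \<in> N - L" "delta h - 1 \<in> V k" using \<open>k \<in> K\<close> by (auto simp: K_def D_def)
    ultimately have "delta h = delta 0" by auto
    then show False using \<open>h \<in> N - L\<close> subgroup_add_zero[OF sL] by (simp only: delta_eq_iff) simp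
  qed
  then have "finite K" by (meson finite_lessThan finite_subset lessThan_iff subsetI)
  moreover have "0 \<in> K" using assms(3) by (auto simp: K_def D_def)
  ultimately have k: "Max K \<in> K" "Suc (Max K) \<notin> K"
    using Max_in Max_ge by (blast, metis Suc_n_not_le_n)
  then obtain h where h: "h \<in> N" "h \<notin> L" "h \<in> D (Max K)" by (auto simp: K_def)
  obtain e where "nmul (p ^ e) h = 0" using ex_p_power_multiple_zero h assms(4) by blast
  then have ex: "\<exists>e. nmul (p ^ e) h \<in> L" using subgroup_add_zero[OF sL] by metis
  define e where "e = (LEAST e. nmul (p ^ e) h \<in> L)"
  have e: "nmul (p ^ e) h \<in> L" unfolding e_def using ex by (rule LeastI_ex)
  have "e \<noteq> 0" using e h by (cases e) auto
  then obtain d where d: "e = Suc d" by (cases e) auto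
  define z where "z = nmul (p ^ d) h"
  show thesis
  proof
    have "d < (LEAST e. nmul (p ^ e) h \<in> L)" using d e_def by simp
    then show "z \<notin> L" unfolding z_def by (rule not_less_Least)
    show "nmul p z \<in> L" using e by (simp add: z_def d flip: nmul_mult)
    show z: "z \<in> N" unfolding z_def using h sN by (auto intro: nmul_closed)
    fix g
    have "delta z - 1 \<in> V (Max K)"
      using nmul_closed[OF normal_subgroup_addD[OF D] h(3)] by (simp add: z_def D_def)
    then have "lie_bracket (delta z - 1) (delta g) \<in> V (Suc (Max K))"
      by (rule bracket_lie_filtration)
    then have "group_comm z g \<in> D (Suc (Max K))"
      unfolding D_def by (simp add: lie_bracket_diff_left group_comm_in_ideal[OF ideal_V])
    moreover have "group_comm z g \<in> N" by (rule group_comm_in_normal[OF N z])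
    ultimately show "group_comm z g \<in> L" using k(2) unfolding K_def by blast
  qed
qed

text \<open>
  Let \<open>M\<close> be maximal among the normal subgroups of \<open>G\<close> with \<open>L \<subseteq> M \<subset> N\<close>.  Adjoining to it an
  element of \<open>N - M\<close> that is central modulo \<open>M\<close> yields a normal subgroup, hence all of \<open>N\<close>.  So \<open>N/M\<close> is
  central of order \<open>p\<close> and every element outside \<open>M\<close> generates it.
\<close>

lemma ex_chief_step:
  assumes L: "normal_subgroup_add L" and N: "normal_subgroup_add N" and LN: "L \<subset> N" "N \<subseteq> G'"
  obtains M z where "normal_subgroup_add M" "L \<subseteq> M" "M \<subset> N"
    "\<And>h g. h \<in> N \<Longrightarrow> group_comm h g \<in> M"
    "\<And>h. h \<in> N \<Longrightarrow> h \<notin> M \<Longrightarrow> subgroup_add hull (insert h M) = N"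
    "z \<in> N" "z \<notin> M" "nmul p z \<in> M" "card N = p * card M"
proof -
  define S where "S = {M. normal_subgroup_add M \<and> L \<subseteq> M \<and> M \<subset> N}"
  have "finite N" using finite_G' LN by (auto intro: finite_subset)
  then have "finite S" unfolding S_def by (auto intro: finite_subset[of _ "Pow N"])
  moreover have "L \<in> S" using L LN by (simp add: S_def)
  ultimately obtain M where M: "M \<in> S" and max: "\<And>M'. M' \<in> S \<Longrightarrow> M \<subseteq> M' \<Longrightarrow> M = M'"
    using finite_has_maximal[of S] by blast
  have nM: "normal_subgroup_add M" "L \<subseteq> M" "M \<subset> N" using M by (auto simp: S_def)
  have gen: "subgroup_add hull (insert h M) = N"
    if h: "h \<in> N" "h \<notin> M" "\<And>g. group_comm h g \<in> M" for h
  proof (rule ccontr)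
    assume ne: "subgroup_add hull (insert h M) \<noteq> N"
    have "subgroup_add hull (insert h M) \<subseteq> N"
      using h nM normal_subgroup_addD[OF N] by (intro hull_minimal) auto
    moreover have sub: "insert h M \<subseteq> subgroup_add hull (insert h M)" by (rule hull_subset)
    ultimately have "subgroup_add hull (insert h M) \<in> S"
      using ne nM normal_hull_insert[OF nM(1) h(3)] by (auto simp: S_def)
    then have "M = subgroup_add hull (insert h M)" using max sub by blast
    then show False using h sub by blast
  qed
  obtain z where z: "z \<in> N" "z \<notin> M" "\<And>g. group_comm z g \<in> M" "nmul p z \<in> M"
    using ex_central_element[OF nM(1) N nM(3) LN(2)] by blast
  have N_eq: "subgroup_add hull (insert z M) = N" by (rule gen[OF z(1-3)])
  have comm: "group_comm h g \<in> M" if "h \<in> N" for h g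
    using group_comm_hull_insert[OF nM(1) z(3)] that N_eq by blast
  show thesis
  proof (rule that[OF nM comm _ z(1,2,4)])
    show "subgroup_add hull (insert h M) = N" if "h \<in> N" "h \<notin> M" for h
      using gen[OF that comm[OF that(1)]] .
    show "card N = p * card M"
      using card_hull_insert[OF nM(1) prime_p z(4,2)] N_eq by simp
  qed
qed

text \<open>
  Descending one chief factor below \<open>N\<close> multiplies the number of commutators by \<open>p\<close>, and divides
  the order of the subgroup by \<open>p\<close>.
\<close>

lemma lie_filtration_lift_normal:
  assumes "normal_subgroup_add N" "N \<subseteq> G'" "V k \<subseteq> aug_ideal N"
  shows "V (k * card N) = {0}"
  using assms
proof (induction "card N" arbitrary: N k rule: less_induct)
  case less
  have sN: "subgroup_add N" using less.prems by (blast dest: normal_subgroup_addD)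
  show ?case
  proof (cases "N = {0}")
    case True
    then show ?thesis using less.prems(3) two_sided_ideal_zero[OF ideal_V[of k]] by (auto simp: aug_ideal_zero)
  next
    case False
    then have "{0} \<subset> N" using subgroup_add_zero[OF sN] by auto
    then obtain M z where M: "normal_subgroup_add M" "M \<subset> N"
      "\<And>h g. h \<in> N \<Longrightarrow> group_comm h g \<in> M"
      "\<And>h. h \<in> N \<Longrightarrow> h \<notin> M \<Longrightarrow> subgroup_add hull (insert h M) = N"
      "z \<in> N" "z \<notin> M" "nmul p z \<in> M" "card N = p * card M"
      using ex_chief_step[OF normal_subgroup_add_singleton less.prems(1) _ less.prems(2)] by metis
    have finN: "finite N" using finite_G' less.prems(2) by (rule finite_subset[rotated])
    have "aug_ideal N \<subseteq> coset_mult (delta z - 1) UNIV (aug_ideal M)"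
      using aug_ideal_hull_insert[of z M] M(3,4)[OF M(5)] M(6) by simp
    moreover have "(delta z - 1) ^ p \<in> aug_ideal M"
      using M(7) by (simp add: delta_diff_one_power_p aug_idealI)
    ultimately have "V (k * p) \<subseteq> aug_ideal M"
      using lie_filtration_lift[OF ideal_aug bracket_in_aug_ideal[OF M(3)[OF M(5)]]] less.prems(3) by blast
    then have "V (k * p * card M) = {0}"
      using less.hyps[OF psubset_card_mono[OF finN M(2)] M(1)] M(2) less.prems(2) by blast
    then show ?thesis by (simp add: M(8) mult.assoc)
  qed
qed

section \<open>Generators modulo the Frattini subgroup\<close>

text \<open>
  The product ideal \<open>V 1 V k\<close>.  For \<open>k = 1\<close> it detects the Frattini subgroup: modulo
  \<open>(V 1)\<^sup>2\<close> the map \<open>h \<mapsto> h - 1\<close> is additive and kills \<open>p\<close>-th powers.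
\<close>

definition V1_mult :: "nat \<Rightarrow> ('g, 'k) group_algebra set" where
  "V1_mult k = two_sided_ideal hull {u * v | u v. u \<in> V 1 \<and> v \<in> V k}"

lemma ideal_V1_mult: "two_sided_ideal (V1_mult k)"
  by (simp add: V1_mult_def two_sided_ideal_hull)

definition frattini :: "'g set" where
  "frattini = {h \<in> G'. delta h - 1 \<in> V1_mult 1}"

lemma normal_frattini: "normal_subgroup_add frattini"
  using normal_subgroup_of_ideal[OF ideal_V1_mult, of 1] normal_commutator_subgroup
  by (auto simp: frattini_def normal_subgroup_add_def subgroup_add_def)

lemma frattini_subset: "frattini \<subseteq> G'"
  by (auto simp: frattini_def)

lemma nmul_p_in_frattini:
  assumes "h \<in> G'"
  shows "nmul p h \<in> frattini"
proof -
  obtain m where m: "p = Suc (Suc m)" using prime_p by (metis Suc_pred less_2_cases_iff not0_implies_Suc not_less_eq numeral_2_eq_2 old.nat.exhaust prime_ge_2_nat not_less)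
  have "(delta h - 1) * (delta h - 1) \<in> V1_mult 1"
    unfolding V1_mult_def using delta_in_V_1[OF assms] by (blast intro: hull_inc)
  then have "(delta h - 1) ^ p \<in> V1_mult 1"
    by (simp add: m two_sided_ideal_mult_right[OF ideal_V1_mult] flip: mult.assoc)
  then show ?thesis
    using assms nmul_closed[OF subgroup_commutator_subgroup] by (simp add: frattini_def delta_diff_one_power_p)
qed

lemma coset_mult_right_ideal:
  assumes J: "two_sided_ideal J"
  shows "\<And>u v. u \<in> coset_mult x UNIV J \<Longrightarrow> v \<in> coset_mult x UNIV J \<Longrightarrow> u + v \<in> coset_mult x UNIV J"
    and "\<And>u r. u \<in> coset_mult x UNIV J \<Longrightarrow> u * r \<in> coset_mult x UNIV J"
    and "0 \<in> coset_mult x UNIV J"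
proof -
  fix u v assume "u \<in> coset_mult x UNIV J" "v \<in> coset_mult x UNIV J"
  then obtain r j s i where "u = x * r + j" "v = x * s + i" "j \<in> J" "i \<in> J" by (metis coset_multE)
  then have "u + v = x * (r + s) + (j + i)" "j + i \<in> J"
    using two_sided_ideal_add[OF J] by (simp_all add: algebra_simps)
  then show "u + v \<in> coset_mult x UNIV J" using coset_multI by (metis UNIV_I)
next
  fix u r assume "u \<in> coset_mult x UNIV J"
  then obtain s j where "u = x * s + j" "j \<in> J" by (metis coset_multE)
  then have "u * r = x * (s * r) + j * r" "j * r \<in> J"
    using two_sided_ideal_mult_right[OF J] by (simp_all add: algebra_simps)
  then show "u * r \<in> coset_mult x UNIV J" using coset_multI by (metis UNIV_I)
next
  show "0 \<in> coset_mult x UNIV J"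
    using subset_coset_mult[of UNIV J x] two_sided_ideal_zero[OF J] by blast
qed

text \<open>
  Nakayama's lemma for the nilpotent ideal \<open>V 1\<close>: with \<open>x = a - 1\<close>, the hypothesis gives
  \<open>V 1 \<subseteq> x R + V 1 V 1\<close>, and substituting this inclusion into itself gives \<open>V 1 \<subseteq> x R + V 1 V k\<close> for
  all \<open>k\<close>, so \<open>V 1 \<subseteq> x R\<close>.  The sum of the coefficients over the subgroup generated by \<open>a\<close> vanishes
  on \<open>x R\<close>, hence on \<open>h - 1\<close> for \<open>h \<in> G'\<close>, which puts \<open>h\<close> into that subgroup.
\<close>

lemma generator_mod_frattini:
  assumes a: "a \<in> G'" and gen: "subgroup_add hull (insert a frattini) = G'"
  shows "subgroup_add hull {a} = G'"
proof -
  define x where "x = delta a - 1"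
  define X where "X k = coset_mult x UNIV (V1_mult k)" for k
  have X: "\<And>k u v. u \<in> X k \<Longrightarrow> v \<in> X k \<Longrightarrow> u + v \<in> X k"
    "\<And>k u r. u \<in> X k \<Longrightarrow> u * r \<in> X k" "\<And>k. 0 \<in> X k"
    unfolding X_def by (rule coset_mult_right_ideal[OF ideal_V1_mult]; assumption)+
  \<comment> \<open>The base of the substitution: the right ideal \<open>X 1 = x R + V 1 V 1\<close> contains the generators.\<close>
  have "V 1 \<subseteq> X 1"
    unfolding V_1_eq aug_ideal_def
  proof (rule two_sided_ideal_hull_subset_right_ideal[OF X])
    have "x \<in> X 1" unfolding X_def using mult_in_coset_mult[OF ideal_V1_mult, of 1 UNIV x] by simp
    moreover have "V1_mult 1 \<subseteq> X 1" unfolding X_def by (rule subset_coset_mult) simp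
    ultimately have "insert a frattini \<subseteq> {h. delta h - 1 \<in> X 1}" by (auto simp: x_def frattini_def)
    then have G'X: "G' \<subseteq> {h. delta h - 1 \<in> X 1}"
      unfolding gen[symmetric] by (intro hull_minimal subgroup_of_right_ideal X)
    fix w r assume "w \<in> (\<lambda>h. delta h - 1) ` G'"
    then obtain h where h: "h \<in> G'" "w = delta h - 1" by blast
    show "r * w \<in> X 1"
    proof (induction r rule: group_algebra_induct)
      case (single c g)
      have "g + h + - g \<in> G'"
        using normal_subgroup_add_conj[OF normal_commutator_subgroup h(1), of "- g"] by simp
      then have "(delta (g + h + - g) - 1) * (delta g * Poly_Mapping.single 0 c) \<in> X 1"
        using G'X X(2) by blast
      moreover have "Poly_Mapping.single 0 c * delta g * w = (delta (g + h + - g) - 1) * (delta g * Poly_Mapping.single 0 c)"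
      proof -
        have "Poly_Mapping.single 0 c * delta g * w = (delta g * w) * Poly_Mapping.single 0 c"
          by (simp add: mult.assoc) (simp add: scalar_commute mult.assoc)
        moreover have "delta g * w = (delta (g + h + - g) - 1) * delta g"
          by (simp only: h right_diff_distrib left_diff_distrib group_add_normalize mult_1_left mult_1_right flip: delta_add)
        ultimately show ?thesis by (simp add: mult.assoc)
      qed
      ultimately show ?case by simp
    qed (simp_all add: X distrib_right)
  qed
  moreover have "V1_mult k \<subseteq> X (Suc k)" for k
    unfolding V1_mult_def[of k]
  proof (rule two_sided_ideal_hull_subset_right_ideal[OF X])
    have V1V: "b * v \<in> V1_mult (Suc k)" if b: "b \<in> V1_mult 1" and v: "v \<in> V k" for b v
    proof -
      have "two_sided_ideal {b. \<forall>v\<in>V k. b * v \<in> V1_mult (Suc k)}"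
        unfolding two_sided_ideal_def using two_sided_ideal_closed[OF ideal_V1_mult] two_sided_ideal_mult_left[OF ideal_V]
        by (auto simp: distrib_right mult.assoc)
      moreover have "u * v * w \<in> V1_mult (Suc k)" if "u \<in> V 1" "v \<in> V 1" "w \<in> V k" for u v w
      proof -
        have "v * w \<in> V (Suc k)" using lie_filtration_mult[OF that(2,3)] by simp
        then show ?thesis unfolding V1_mult_def mult.assoc using that(1) by (blast intro: hull_inc)
      qed
      ultimately have "V1_mult 1 \<subseteq> {b. \<forall>v\<in>V k. b * v \<in> V1_mult (Suc k)}"
        unfolding V1_mult_def[of 1] by (intro hull_minimal) auto
      then show ?thesis using b v by blast
    qed
    fix w r assume "w \<in> {u * v |u v. u \<in> V 1 \<and> v \<in> V k}"
    then obtain u v where uv: "u \<in> V 1" "v \<in> V k" "w = u * v" by blast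
    have "r * u \<in> X 1" using \<open>V 1 \<subseteq> X 1\<close> uv(1) two_sided_ideal_mult_left[OF ideal_V] by blast
    then obtain s b where sb: "b \<in> V1_mult 1" "r * u = x * s + b" unfolding X_def by (rule coset_multE)
    then have "r * w = x * (s * v) + b * v" by (simp add: uv(3) distrib_right flip: mult.assoc)
    then show "r * w \<in> X (Suc k)" using V1V[OF sb(1) uv(2)] unfolding X_def by (metis UNIV_I coset_multI)
  qed
  then have "X k \<subseteq> X (Suc k)" for k
  proof -
    have "x * r + j \<in> X (Suc k)" if "j \<in> V1_mult k" for r j
    proof (rule X(1))
      show "x * r \<in> X (Suc k)" unfolding X_def by (rule mult_in_coset_mult[OF ideal_V1_mult]) simp
      show "j \<in> X (Suc k)" using that \<open>V1_mult k \<subseteq> X (Suc k)\<close> by blast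
    qed
    then show ?thesis by (auto simp: X_def[of k] elim: coset_multE)
  qed
  then have "X 1 \<subseteq> X (Suc n)" by (rule lift_Suc_mono_le) simp
  ultimately have V1: "V 1 \<subseteq> X (Suc n)" by blast
  have "V (Suc n) = {0}"
    using V_antimono[of n "Suc n"] V_n two_sided_ideal_zero[OF ideal_V[of "Suc n"]] by auto
  then have "V1_mult (Suc n) \<subseteq> {0}"
    unfolding V1_mult_def by (intro hull_minimal two_sided_ideal_singleton_zero) auto
  then have V1x: "\<exists>r. u = x * r" if "u \<in> V 1" for u
    using V1 that by (fastforce simp: X_def elim: coset_multE)
  let ?H = "subgroup_add hull {a}"
  have H: "subgroup_add ?H" by (rule subgroup_add_hull)
  have aH: "a \<in> ?H" by (auto intro: hull_inc)
  have HG: "?H \<subseteq> G'" using a subgroup_commutator_subgroup by (intro hull_minimal) auto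
  then have finH: "finite ?H" using finite_G' by (rule finite_subset)
  \<comment> \<open>The functional that separates \<open>x R\<close> from \<open>h - 1\<close> for \<open>h\<close> outside the subgroup generated by \<open>a\<close>.\<close>
  define \<phi> where "\<phi> r = (\<Sum>g\<in>?H. Poly_Mapping.lookup r g)" for r :: "('g, 'k) group_algebra"
  have "\<phi> (delta a * r) = \<phi> r" for r
    unfolding \<phi>_def lookup_delta_mult
    by (rule sum.reindex_bij_witness[of _ "\<lambda>g. a + g" "\<lambda>g. - a + g"])
      (use aH H in \<open>auto intro: subgroup_add_closed\<close>)
  then have \<phi>x: "\<phi> (x * r) = 0" for r
    by (simp add: x_def left_diff_distrib) (simp add: \<phi>_def lookup_minus sum_subtractf)
  have \<phi>delta: "\<phi> (delta h) = (if h \<in> ?H then 1 else 0)" for h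
    unfolding \<phi>_def lookup_delta using finH by simp
  have "h \<in> ?H" if "h \<in> G'" for h
  proof (rule ccontr)
    assume "h \<notin> ?H"
    have "\<phi> (delta h - 1) = 0" using V1x[OF delta_in_V_1[OF that]] \<phi>x by metis
    moreover have "\<phi> (delta h - 1) = \<phi> (delta h) - \<phi> (delta 0)" by (simp add: \<phi>_def lookup_minus sum_subtractf)
    ultimately show False
      using \<open>h \<notin> ?H\<close> subgroup_add_zero[OF H] by (simp only: \<phi>delta) simp
  qed
  then show ?thesis using HG by blast
qed

section \<open>Commutator subgroups that are not cyclic\<close>

text \<open>
  Put \<open>x = a - 1\<close>, \<open>y = b - 1\<close> and \<open>J = aug_ideal M\<close>.  By lifting over \<open>a\<close>, \<open>V (p - 1)\<close> is
  contained in \<open>x\<^sup>p\<^sup>-\<^sup>1 R + y R + J\<close>.  One further commutator \<open>[x\<^sup>p\<^sup>-\<^sup>1 r, s]\<close> produces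
  \<open>x\<^sup>p\<^sup>-\<^sup>1 [r, s]\<close> and \<open>[x\<^sup>p\<^sup>-\<^sup>1, s] r\<close>.  Modulo \<open>J\<close>, both are multiples of \<open>y\<close> by elements of \<open>V 1\<close>: the
  first because \<open>x\<^sup>p \<in> J\<close>, the second because \<open>[x, s]\<close> is a multiple of \<open>y\<close> and, for \<open>p \<ge> 3\<close>, some
  factor \<open>x\<close> is left over; if \<open>a\<close> is central modulo \<open>M\<close>, then \<open>[x, s] \<in> J\<close> and it vanishes.  Hence \<open>V p \<subseteq> y V 1 + J\<close>, one commutator better than \<open>y R + J\<close>, and the
  strong lifting applies.
\<close>

lemma V_subset_aug_of_rank_two:
  assumes ab: "a \<in> G'" "b \<in> G'"
    and G'_eq: "subgroup_add hull (insert a Q) = G'" and Q_eq: "subgroup_add hull (insert b M) = Q"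
    and aG: "\<And>g. group_comm a g \<in> Q" and bG: "\<And>g. group_comm b g \<in> M"
    and pa: "nmul p a \<in> M" and pb: "nmul p b \<in> M"
    and weight: "3 \<le> p \<or> (\<forall>g. group_comm a g \<in> M)"
  shows "V (p * p - 1) \<subseteq> aug_ideal M"
proof -
  define x y where "x = delta a - 1" and "y = delta b - 1"
  define W where "W = coset_mult y (V 1) (aug_ideal M)"
  have p2: "2 \<le> p" using prime_p by (rule prime_ge_2_nat)
  have xy: "x \<in> V 1" "y \<in> V 1" unfolding x_def y_def by (intro delta_in_V_1 ab)+
  have xp: "x ^ p \<in> aug_ideal M" "y ^ p \<in> aug_ideal M"
    using pa pb by (auto simp: x_def y_def delta_diff_one_power_p intro: aug_idealI)
  have x_br: "lie_bracket x r \<in> aug_ideal Q" for r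
    unfolding x_def by (rule bracket_in_aug_ideal[OF aG])
  have y_br: "lie_bracket y r \<in> aug_ideal M" for r
    unfolding y_def by (rule bracket_in_aug_ideal[OF bG])
  have Qy: "aug_ideal Q \<subseteq> coset_mult y UNIV (aug_ideal M)"
    using aug_ideal_hull_insert[OF bG] by (simp add: Q_eq y_def)
  have Vx: "V 1 \<subseteq> coset_mult x UNIV (aug_ideal Q)"
    using aug_ideal_hull_insert[OF aG] by (simp only: G'_eq x_def V_1_eq)
  have W: "two_sided_ideal W"
    unfolding W_def by (rule two_sided_ideal_coset_mult[OF ideal_aug ideal_V y_br])
  have MW: "aug_ideal M \<subseteq> W"
    unfolding W_def by (rule subset_coset_mult[OF two_sided_ideal_zero[OF ideal_V]])
  have yW: "y * v \<in> W" if "v \<in> V 1" for v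
    unfolding W_def by (rule mult_in_coset_mult[OF ideal_aug that])
  have QV: "q * v \<in> W" if q: "q \<in> aug_ideal Q" and v: "v \<in> V 1" for q v
  proof -
    obtain r j where q: "j \<in> aug_ideal M" "q = y * r + j" using q Qy by (meson coset_multE subsetD)
    have "q * v = y * (r * v) + j * v" by (simp add: q distrib_right mult.assoc)
    moreover have "y * (r * v) \<in> W" using yW two_sided_ideal_mult_left[OF ideal_V v] by blast
    moreover have "j * v \<in> W" using q MW two_sided_ideal_mult_right[OF W] by blast
    ultimately show ?thesis using two_sided_ideal_add[OF W] by metis
  qed
  have VQ: "v * q \<in> W" if q: "q \<in> aug_ideal Q" and v: "v \<in> V 1" for q v
  proof -
    obtain r j where q: "j \<in> aug_ideal M" "q = y * r + j" using q Qy by (meson coset_multE subsetD)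
    have "v * q = y * (v * r) + (v * j - lie_bracket y v * r)" by (simp add: q lie_bracket_def algebra_simps)
    moreover have "y * (v * r) \<in> W" using yW two_sided_ideal_mult_right[OF ideal_V v] by blast
    moreover have "v * j - lie_bracket y v * r \<in> aug_ideal M"
      using q y_br ideal_aug by (blast intro: two_sided_ideal_closed)
    ultimately show ?thesis using MW W two_sided_ideal_add by fastforce
  qed
  have x_pow: "x ^ Suc k \<in> V 1" for k
    by (rule two_sided_ideal_power[OF ideal_V xy(1)]) simp
  have x_pow_br: "lie_bracket (x ^ (p - 1)) s \<in> W" for s
    using weight
  proof
    assume "\<forall>g. group_comm a g \<in> M"
    then have "lie_bracket x s \<in> aug_ideal M"
      unfolding x_def by (intro bracket_in_aug_ideal) blast
    then have "lie_bracket (x ^ k) s \<in> aug_ideal M" for k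
      by (induction k) (simp_all add: lie_bracket_mult_left two_sided_ideal_closed[OF ideal_aug])
    then show ?thesis using MW by blast
  next
    assume "3 \<le> p"
    have "lie_bracket (x ^ Suc (Suc k)) s \<in> W" for k
    proof (induction k)
      case 0
      show ?case using QV[OF x_br xy(1)] VQ[OF x_br xy(1)] W
        by (simp add: lie_bracket_mult_left two_sided_ideal_add)
    next
      case (Suc k)
      have "lie_bracket (x ^ Suc (Suc (Suc k))) s
          = x * lie_bracket (x ^ Suc (Suc k)) s + lie_bracket x s * x ^ Suc (Suc k)"
        by (simp add: lie_bracket_mult_left)
      then show ?case
        using Suc QV[OF x_br x_pow] W by (simp only: two_sided_ideal_add two_sided_ideal_mult_left)
    qed
    from this[of "p - 3"] show ?thesis using \<open>3 \<le> p\<close> by (simp add: numeral_3_eq_3 Suc_diff_Suc)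
  qed
  have Vp1: "V (p - 1) \<subseteq> coset_mult (x ^ (p - 1)) UNIV (aug_ideal Q)"
    using lie_filtration_lift_power[OF ideal_aug x_br Vx, of "p - 1"] by simp
  have "V (Suc (p - 1)) \<subseteq> W"
  proof (rule lie_filtration_Suc_least[OF W])
    fix u s assume "u \<in> V (p - 1)"
    then obtain r q where q: "q \<in> aug_ideal Q" and u: "u = x ^ (p - 1) * r + q"
      using Vp1 by (meson coset_multE subsetD)
    obtain t j where j: "j \<in> aug_ideal M" "q = y * t + j" using q Qy by (meson coset_multE subsetD)
    have comm: "lie_bracket v s \<in> V 1" for v using bracket_lie_filtration[of v 0 s] by simp
    have "lie_bracket q s = y * lie_bracket t s + (lie_bracket y s * t + lie_bracket j s)"
      by (simp add: j lie_bracket_add_left lie_bracket_mult_left)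
    moreover have "lie_bracket y s * t + lie_bracket j s \<in> aug_ideal M"
      using y_br j ideal_aug by (blast intro: two_sided_ideal_closed two_sided_ideal_bracket)
    ultimately have 1: "lie_bracket q s \<in> W" using MW W yW[OF comm] two_sided_ideal_add by fastforce
    obtain r' q' where q': "q' \<in> aug_ideal Q" "lie_bracket r s = x * r' + q'"
      using Vx comm by (meson coset_multE subsetD)
    have "x ^ (p - 1) * lie_bracket r s = x ^ p * r' + x ^ (p - 1) * q'"
      using power_minus_mult[of p x] p2 by (simp only: q' distrib_left flip: mult.assoc)
    moreover have "x ^ (p - 1) * q' \<in> W"
      using VQ[OF q'(1) x_pow[of "p - 2"]] p2 by (simp add: numeral_2_eq_2 Suc_diff_Suc)
    moreover have "x ^ p * r' \<in> W" using xp MW W two_sided_ideal_mult_right by blast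
    ultimately have "x ^ (p - 1) * lie_bracket r s \<in> W" using W two_sided_ideal_add by fastforce
    moreover have "lie_bracket u s
        = x ^ (p - 1) * lie_bracket r s + lie_bracket (x ^ (p - 1)) s * r + lie_bracket q s"
      by (simp add: u lie_bracket_add_left lie_bracket_mult_left)
    ultimately show "lie_bracket u s \<in> W"
      using 1 x_pow_br two_sided_ideal_add[OF W] two_sided_ideal_mult_right[OF W] by metis
  qed
  then have "V (Suc (p * (p - 1))) \<subseteq> aug_ideal M"
    using lie_filtration_lift_strong[OF ideal_aug y_br, of "p - 1"] xp p2 unfolding W_def by auto
  moreover have "Suc (p * (p - 1)) \<le> p * p - 1"
    using p2 by (cases p) auto
  ultimately show ?thesis using V_antimono by blast
qed

text \<open>
  If \<open>(q, G) \<subseteq> M\<close> and \<open>M\<close> is central modulo \<open>L\<close>, then \<open>g \<mapsto> (q, g)\<close> is a homomorphism from \<open>G\<close> to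
  the abelian group \<open>M/L\<close>, so it is trivial on \<open>G'\<close>.  The computation takes place in the ring
  modulo \<open>aug_ideal L\<close>, where elements of \<open>M\<close> become central units.
\<close>

lemma commutator_centralizes_mod:
  assumes M: "\<And>h g. h \<in> M \<Longrightarrow> group_comm h g \<in> L"
    and q: "\<And>g. group_comm q g \<in> M" and h: "h \<in> G'"
  shows "lie_bracket (delta q) (delta h) \<in> aug_ideal L"
proof -
  let ?J = "aug_ideal L"
  note J = two_sided_ideal_closed[OF ideal_aug[of L]]
  define \<phi> where "\<phi> g = delta (group_comm q g)" for g
  have central: "lie_bracket (\<phi> g) r \<in> ?J" for g r
    using bracket_in_aug_ideal[of "group_comm q g" L r] M[OF q]
    by (simp add: \<phi>_def lie_bracket_diff_left)
  have hom: "\<phi> (g + h) - \<phi> h * \<phi> g \<in> ?J" for g h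
  proof -
    have "\<phi> (g + h) = \<phi> h * (delta (- h) * (\<phi> g * delta h))"
      by (simp add: \<phi>_def group_comm_add_right delta_add mult.assoc)
    moreover have "\<phi> g * delta h = lie_bracket (\<phi> g) (delta h) + delta h * \<phi> g"
      by (simp add: lie_bracket_def)
    ultimately have "\<phi> (g + h) - \<phi> h * \<phi> g = \<phi> h * (delta (- h) * lie_bracket (\<phi> g) (delta h))"
      by (simp add: distrib_left delta_inverse_cancel)
    then show ?thesis using central J by simp
  qed
  have unit: "u \<in> ?J" if "u * \<phi> g \<in> ?J" for u g
  proof -
    have "u * \<phi> g * delta (- group_comm q g) \<in> ?J" using that J by blast
    then show ?thesis by (simp add: \<phi>_def mult.assoc delta_inverse)
  qed
  have "lie_bracket (delta q) (delta (group_comm g h)) \<in> ?J" for g h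
  proof -
    let ?c = "group_comm g h"
    have 1: "\<phi> (g + h) - \<phi> ?c * \<phi> (h + g) \<in> ?J"
      using hom[of "h + g" ?c] by (simp add: add_group_comm)
    have 2: "\<phi> ?c * (\<phi> (h + g) - \<phi> g * \<phi> h) \<in> ?J" using hom J(3) by blast
    have 3: "\<phi> ?c * lie_bracket (\<phi> g) (\<phi> h) \<in> ?J" using central J(3) by blast
    have "(\<phi> (g + h) - \<phi> h * \<phi> g) - (\<phi> (g + h) - \<phi> ?c * \<phi> (h + g))
        - \<phi> ?c * (\<phi> (h + g) - \<phi> g * \<phi> h) - \<phi> ?c * lie_bracket (\<phi> g) (\<phi> h) \<in> ?J"
      by (intro two_sided_ideal_diff[OF ideal_aug] hom 1 2 3)
    then have "(\<phi> ?c - 1) * \<phi> h * \<phi> g \<in> ?J"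
      by (simp add: lie_bracket_def algebra_simps)
    then have "\<phi> ?c - 1 \<in> ?J" by (blast intro: unit)
    then show ?thesis unfolding bracket_delta \<phi>_def[symmetric] using J by blast
  qed
  moreover have "subgroup_add {h. lie_bracket (delta q) (delta h) \<in> ?J}"
    unfolding subgroup_add_def
  proof (intro conjI ballI)
    show "0 \<in> {h. lie_bracket (delta q) (delta h) \<in> ?J}" using J by simp
    fix h assume h: "h \<in> {h. lie_bracket (delta q) (delta h) \<in> ?J}"
    have "lie_bracket (delta q) (delta (- h)) = - (delta (- h) * lie_bracket (delta q) (delta h) * delta (- h))"
      by (simp add: lie_bracket_def algebra_simps delta_inverse delta_inverse_cancel)
    then show "- h \<in> {h. lie_bracket (delta q) (delta h) \<in> ?J}" using h J by simp
    fix k assume k: "k \<in> {h. lie_bracket (delta q) (delta h) \<in> ?J}"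
    then show "h + k \<in> {h. lie_bracket (delta q) (delta h) \<in> ?J}"
      using h J by (simp add: delta_add lie_bracket_mult_right)
  qed
  ultimately have "G' \<subseteq> {h. lie_bracket (delta q) (delta h) \<in> ?J}"
    by (intro commutator_subgroup_least) auto
  then show ?thesis using h by blast
qed

text \<open>
  Put \<open>x = a - 1\<close>, \<open>y = b - 1\<close>, \<open>z = w - 1\<close>; these have weights 1, 2, 3.  The point is that
  \<open>y\<^sup>2 \<in> aug_ideal L\<close>: conjugation by \<open>g\<close> maps \<open>a\<close> to \<open>a b\<close>, where \<open>a\<close> and \<open>b\<close> commute modulo \<open>L\<close> and
  \<open>a\<^sup>2\<close> is central modulo \<open>L\<close>, whence \<open>a\<^sup>2 b\<^sup>2 = a\<^sup>2\<close> modulo \<open>L\<close>.  Therefore four commutators lead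
  into \<open>z V 1\<close> modulo \<open>aug_ideal L\<close>, and the strong lifting gives \<open>1 + 2 \<cdot> 3 = 7\<close>.
\<close>

lemma V_7_subset_aug_of_three_steps:
  assumes p: "p = 2"
    and ab: "a \<in> G'" "b \<in> G'" and b: "b = group_comm a g"
    and G'_eq: "subgroup_add hull (insert a Q) = G'" and Q_eq: "subgroup_add hull (insert b M) = Q"
    and M_eq: "subgroup_add hull (insert w L) = M"
    and aG: "\<And>g. group_comm a g \<in> Q" and bG: "\<And>g. group_comm b g \<in> M"
    and MG: "\<And>h g. h \<in> M \<Longrightarrow> group_comm h g \<in> L"
    and pa: "nmul p a \<in> M" and pw: "nmul p w \<in> L"
  shows "V 7 \<subseteq> aug_ideal L"
proof -
  let ?J = "aug_ideal L"
  note J = two_sided_ideal_closed[OF ideal_aug[of L]]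
  define x y z where "x = delta a - 1" and "y = delta b - 1" and "z = delta w - 1"
  have sub: "M \<subseteq> Q" using Q_eq by (auto intro: hull_inc)
  have wM: "w \<in> M" using M_eq by (auto intro: hull_inc)
  have wG: "group_comm w g \<in> L" for g by (rule MG[OF wM])
  have x_br: "lie_bracket x r \<in> aug_ideal Q" for r
    unfolding x_def by (rule bracket_in_aug_ideal[OF aG])
  have y_br: "lie_bracket y r \<in> aug_ideal M" for r
    unfolding y_def by (rule bracket_in_aug_ideal[OF bG])
  have z_br: "lie_bracket z r \<in> ?J" for r
    unfolding z_def by (rule bracket_in_aug_ideal[OF wG])
  have M_br: "lie_bracket (delta m) r \<in> ?J" if "m \<in> M" for m r
    using bracket_in_aug_ideal[of m L r] MG[OF that] by (simp add: lie_bracket_diff_left)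
  have Mz: "aug_ideal M \<subseteq> coset_mult z UNIV ?J"
    using aug_ideal_hull_insert[OF wG] by (simp add: M_eq z_def)
  have Qy: "aug_ideal Q \<subseteq> coset_mult y UNIV (aug_ideal M)"
    using aug_ideal_hull_insert[OF bG] by (simp add: Q_eq y_def)
  have Vx: "V 1 \<subseteq> coset_mult x UNIV (aug_ideal Q)"
    using aug_ideal_hull_insert[OF aG] by (simp only: G'_eq x_def V_1_eq)
  have xx: "x * x \<in> aug_ideal M"
    using delta_diff_one_power_p[of a] pa by (simp add: x_def p power2_eq_square aug_idealI)
  have zz: "z ^ 2 \<in> ?J"
    using delta_diff_one_power_p[of w] pw by (simp add: z_def p aug_idealI)
  have yV: "y \<in> V 1" unfolding y_def by (rule delta_in_V_1[OF ab(2)])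
  have yy: "y * y \<in> ?J"
  proof -
    let ?\<alpha> = "delta a" and ?\<beta> = "delta b"
    have nm: "nmul p h = h + h" for h :: 'g by (simp add: p numeral_2_eq_2)
    have "a + b = - g + a + g" by (simp add: b conj_eq_group_comm)
    then have "(a + b) + (a + b) = - g + (a + a) + g" by (simp only: group_add_normalize)
    then have eq: "?\<alpha> * ?\<beta> * (?\<alpha> * ?\<beta>) = delta (- g) * delta (a + a) * delta g" by (simp only: flip: delta_add)
    have "lie_bracket (delta (a + a)) (delta g) \<in> ?J" using M_br pa by (simp add: nm)
    then have "delta (- g) * lie_bracket (delta (a + a)) (delta g) \<in> ?J" using J by blast
    then have 1: "delta (- g) * delta (a + a) * delta g - delta (a + a) \<in> ?J"
      by (simp add: lie_bracket_def right_diff_distrib delta_inverse_cancel mult.assoc)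
    have "lie_bracket ?\<beta> ?\<alpha> \<in> ?J" by (rule commutator_centralizes_mod[OF MG bG ab(1)])
    then have "?\<alpha> * lie_bracket ?\<beta> ?\<alpha> * ?\<beta> \<in> ?J" using J by blast
    then have "?\<alpha> * ?\<beta> * (?\<alpha> * ?\<beta>) - ?\<alpha> * ?\<alpha> * (?\<beta> * ?\<beta>) \<in> ?J"
      by (simp add: lie_bracket_def algebra_simps)
    then have "(delta (- g) * delta (a + a) * delta g - delta (a + a))
        - (?\<alpha> * ?\<beta> * (?\<alpha> * ?\<beta>) - ?\<alpha> * ?\<alpha> * (?\<beta> * ?\<beta>)) \<in> ?J"
      using 1 two_sided_ideal_diff[OF ideal_aug] by blast
    then have "?\<alpha> * ?\<alpha> * (?\<beta> * ?\<beta>) - delta (a + a) \<in> ?J" by (simp only: eq) simp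
    then have "?\<alpha> * (?\<alpha> * (?\<beta> * ?\<beta> - 1)) \<in> ?J" by (simp add: delta_add right_diff_distrib mult.assoc)
    from J(3)[OF J(3)[OF this], of "delta (- a)" "delta (- a)"]
    have "?\<beta> * ?\<beta> - 1 \<in> ?J" by (simp add: delta_inverse_cancel)
    then show ?thesis
      using delta_diff_one_power_p[of b] by (simp add: y_def nm delta_add) (simp add: p power2_eq_square)
  qed
  have comm: "lie_bracket v s \<in> V 1" for v s using bracket_lie_filtration[of v 0 s] by simp
  have V2: "V (Suc 1) \<subseteq> aug_ideal Q"
  proof (rule lie_filtration_Suc_least[OF ideal_aug])
    note K = two_sided_ideal_closed[OF ideal_aug[of Q]]
    fix u s assume "u \<in> V 1"
    then obtain r q where u: "q \<in> aug_ideal Q" "u = x * r + q" using Vx by (meson coset_multE subsetD)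
    obtain r' q' where r': "q' \<in> aug_ideal Q" "lie_bracket r s = x * r' + q'"
      using Vx comm by (meson coset_multE subsetD)
    have "lie_bracket u s = x * x * r' + x * q' + lie_bracket x s * r + lie_bracket q s"
      by (simp add: u lie_bracket_add_left lie_bracket_mult_left r' algebra_simps)
    then show "lie_bracket u s \<in> aug_ideal Q"
      using u r' x_br xx aug_ideal_mono[OF sub] K two_sided_ideal_bracket[OF ideal_aug] by auto
  qed
  have V3: "V (Suc 2) \<subseteq> coset_mult y (V 1) (aug_ideal M)"
  proof (rule lie_filtration_Suc_least[OF two_sided_ideal_coset_mult[OF ideal_aug ideal_V y_br]])
    fix u s assume "u \<in> V 2"
    then have "u \<in> aug_ideal Q" using V2 by (auto simp: numeral_2_eq_2)
    then obtain r m where u: "m \<in> aug_ideal M" "u = y * r + m" using Qy by (meson coset_multE subsetD)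
    have "lie_bracket u s = y * lie_bracket r s + (lie_bracket y s * r + lie_bracket m s)"
      by (simp add: u lie_bracket_add_left lie_bracket_mult_left)
    moreover have "lie_bracket y s * r + lie_bracket m s \<in> aug_ideal M"
      using u y_br ideal_aug by (blast intro: two_sided_ideal_closed two_sided_ideal_bracket)
    ultimately show "lie_bracket u s \<in> coset_mult y (V 1) (aug_ideal M)"
      using coset_multI[OF comm] by metis
  qed
  define W where "W = coset_mult z (V 1) ?J"
  have W: "two_sided_ideal W"
    unfolding W_def by (rule two_sided_ideal_coset_mult[OF ideal_aug ideal_V z_br])
  have JW: "?J \<subseteq> W"
    unfolding W_def by (rule subset_coset_mult[OF two_sided_ideal_zero[OF ideal_V]])
  have zW: "z * v \<in> W" if "v \<in> V 1" for v
    unfolding W_def by (rule mult_in_coset_mult[OF ideal_aug that])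
  have MV: "m * v \<in> W" if m: "m \<in> aug_ideal M" and v: "v \<in> V 1" for m v
  proof -
    obtain r j where m: "j \<in> ?J" "m = z * r + j" using m Mz by (meson coset_multE subsetD)
    have "m * v = z * (r * v) + j * v" by (simp add: m distrib_right mult.assoc)
    moreover have "z * (r * v) \<in> W" using zW two_sided_ideal_mult_left[OF ideal_V v] by blast
    moreover have "j * v \<in> W" using m JW two_sided_ideal_mult_right[OF W] by blast
    ultimately show ?thesis using two_sided_ideal_add[OF W] by metis
  qed
  have VM: "v * m \<in> W" if m: "m \<in> aug_ideal M" and v: "v \<in> V 1" for m v
  proof -
    obtain r j where m: "j \<in> ?J" "m = z * r + j" using m Mz by (meson coset_multE subsetD)
    have "v * m = z * (v * r) + (v * j - lie_bracket z v * r)" by (simp add: m lie_bracket_def algebra_simps)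
    moreover have "v * j - lie_bracket z v * r \<in> ?J"
      using J(6)[OF J(3)[OF m(1)] J(4)[OF z_br]] .
    then have "v * j - lie_bracket z v * r \<in> W" using JW by blast
    ultimately show ?thesis
      using zW[OF two_sided_ideal_mult_right[OF ideal_V v]] W two_sided_ideal_add by fastforce
  qed
  have "V (Suc 3) \<subseteq> W"
  proof (rule lie_filtration_Suc_least[OF W])
    fix u s assume "u \<in> V 3"
    then have "u \<in> coset_mult y (V 1) (aug_ideal M)" using V3 by (auto simp: numeral_3_eq_3 numeral_2_eq_2)
    then obtain v m where u: "v \<in> V 1" "m \<in> aug_ideal M" "u = y * v + m" by (rule coset_multE)
    have "lie_bracket v s \<in> aug_ideal Q" using V2 bracket_lie_filtration[OF u(1)] by blast
    then obtain r m' where r: "m' \<in> aug_ideal M" "lie_bracket v s = y * r + m'"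
      using Qy by (meson coset_multE subsetD)
    obtain t j where m: "j \<in> ?J" "m = z * t + j" using u(2) Mz by (meson coset_multE subsetD)
    have "lie_bracket m s = z * lie_bracket t s + (lie_bracket z s * t + lie_bracket j s)"
      by (simp add: m lie_bracket_add_left lie_bracket_mult_left)
    moreover have "lie_bracket z s * t + lie_bracket j s \<in> ?J"
      using J(2)[OF J(4)[OF z_br] two_sided_ideal_bracket[OF ideal_aug m(1)]] .
    then have "lie_bracket z s * t + lie_bracket j s \<in> W" using JW by blast
    ultimately have 1: "lie_bracket m s \<in> W" using zW[OF comm] W two_sided_ideal_add by fastforce
    have "lie_bracket u s = y * y * r + y * m' + lie_bracket y s * v + lie_bracket m s"
      by (simp add: u lie_bracket_add_left lie_bracket_mult_left r algebra_simps)
    moreover have "y * y * r \<in> W" using J(4)[OF yy] JW by blast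
    ultimately show "lie_bracket u s \<in> W"
      using 1 VM[OF r(1) yV] MV[OF y_br u(1)] W by (simp add: two_sided_ideal_add)
  qed
  then have "V (Suc (2 * 3)) \<subseteq> ?J"
    using lie_filtration_lift_strong[OF ideal_aug z_br, where k = 3 and p = 2] zz unfolding W_def by auto
  then show ?thesis by simp
qed

lemma frattini_psubset:
  assumes "subgroup_add hull {0} \<noteq> G'"
  shows "frattini \<subset> G'"
proof -
  have "0 \<in> G'" by (rule subgroup_add_zero[OF subgroup_commutator_subgroup])
  moreover have "subgroup_add hull G' = G'" by (rule hull_same[where S = subgroup_add, OF subgroup_commutator_subgroup])
  ultimately have "frattini \<noteq> G'"
    using generator_mod_frattini[of 0] assms by (metis insert_absorb)
  then show ?thesis using frattini_subset by blast
qed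

text \<open>
  The subgroups \<open>frattini \<subseteq> M \<subset> Q \<subset> G'\<close> come from two chief steps; the second one exists because
  \<open>Q = frattini\<close> would make \<open>G'\<close> cyclic.  Since \<open>M\<close> contains the Frattini subgroup, all \<open>p\<close>-fold
  multiples of elements of \<open>G'\<close> lie in \<open>M\<close>.
\<close>

lemma not_cyclic_cases:
  assumes V_big: "V (card G' - 1) \<noteq> {0}"
    and not_cyclic: "\<And>a. a \<in> G' \<Longrightarrow> subgroup_add hull {a} \<noteq> G'"
  obtains Q a g where "p = 2" "card G' = 4" "normal_subgroup_add Q" "Q \<subset> G'"
    "\<And>h. h \<in> G' \<Longrightarrow> h \<notin> Q \<Longrightarrow> subgroup_add hull (insert h Q) = G'"
    "\<And>h g. h \<in> G' \<Longrightarrow> group_comm h g \<in> Q" "\<And>h g. h \<in> Q \<Longrightarrow> group_comm h g = 0"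
    "\<And>h. h \<in> G' \<Longrightarrow> h + h = 0" "a \<in> G'" "group_comm a g \<noteq> 0"
proof -
  \<comment> \<open>Extremality of the upper index passes to all quotients of \<open>G\<close> by normal subgroups in \<open>P = [G, G]\<close>.\<close>
  have contra: False
    if "normal_subgroup_add N" "N \<subseteq> G'" "V (k - 1) \<subseteq> aug_ideal N" "card G' = k * card N" for N k
  proof -
    have "finite N" "N \<noteq> {}"
      using that finite_G' finite_subset subgroup_add_zero[OF normal_subgroup_addD] by blast+
    then have "0 < card N" by (simp add: card_gt_0_iff)
    then have "(k - 1) * card N \<le> card G' - 1"
      by (simp add: that(4) diff_mult_distrib)
    then have "V (card G' - 1) \<subseteq> {0}"
      using V_antimono lie_filtration_lift_normal[OF that(1-3)] by blast
    then show False using V_big two_sided_ideal_zero[OF ideal_V] by blast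
  qed
  have "frattini \<subset> G'"
    by (rule frattini_psubset[OF not_cyclic[OF subgroup_add_zero[OF subgroup_commutator_subgroup]]])
  then obtain Q a where Q: "normal_subgroup_add Q" "frattini \<subseteq> Q" "Q \<subset> G'"
    "\<And>h g. h \<in> G' \<Longrightarrow> group_comm h g \<in> Q"
    "\<And>h. h \<in> G' \<Longrightarrow> h \<notin> Q \<Longrightarrow> subgroup_add hull (insert h Q) = G'"
    and a: "a \<in> G'" "a \<notin> Q" and cardG: "card G' = p * card Q"
    using ex_chief_step[OF normal_frattini normal_commutator_subgroup] by (metis order_refl)
  have "frattini \<noteq> Q"
    using generator_mod_frattini[OF a(1)] not_cyclic[OF a(1)] Q(5)[OF a] by auto
  then have "frattini \<subset> Q" using Q(2) by blast
  moreover have QG: "Q \<subseteq> G'" using Q(3) by blast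
  ultimately obtain M b0 where M: "normal_subgroup_add M" "frattini \<subseteq> M" "M \<subset> Q"
    "\<And>h g. h \<in> Q \<Longrightarrow> group_comm h g \<in> M"
    "\<And>h. h \<in> Q \<Longrightarrow> h \<notin> M \<Longrightarrow> subgroup_add hull (insert h M) = Q"
    and b0: "b0 \<in> Q" "b0 \<notin> M" and cardQ: "card Q = p * card M"
    using ex_chief_step[OF normal_frattini Q(1)] by metis
  have pM: "nmul p h \<in> M" if "h \<in> G'" for h using nmul_p_in_frattini[OF that] M(2) by blast
  have MG: "M \<subseteq> G'" using M(3) QG by blast
  have "\<not> (3 \<le> p \<or> (\<forall>g. group_comm a g \<in> M))"
  proof
    assume weight: "3 \<le> p \<or> (\<forall>g. group_comm a g \<in> M)"
    have b0G: "b0 \<in> G'" using b0 QG by blast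
    have "V (p * p - 1) \<subseteq> aug_ideal M"
      using V_subset_aug_of_rank_two[OF a(1) b0G Q(5)[OF a] M(5)[OF b0] Q(4)[OF a(1)] M(4)[OF b0(1)]
          pM[OF a(1)] pM[OF b0G] weight] .
    then show False using contra[OF M(1) MG, of "p * p"] by (simp add: cardG cardQ)
  qed
  then obtain g where p: "p = 2" and g: "group_comm a g \<notin> M"
    using prime_ge_2_nat[OF prime_p] by force
  define b where "b = group_comm a g"
  have b: "b \<in> Q" "b \<notin> M" "b \<in> G'" using g Q(4)[OF a(1)] QG by (auto simp: b_def)
  have "M = {0}"
  proof (rule ccontr)
    assume "M \<noteq> {0}"
    then have "{0} \<subset> M" using subgroup_add_zero[OF normal_subgroup_addD[OF M(1)]] by blast
    then obtain L w where L: "normal_subgroup_add L" "L \<subset> M" "\<And>h g. h \<in> M \<Longrightarrow> group_comm h g \<in> L"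
      "subgroup_add hull (insert w L) = M" "nmul p w \<in> L" "card M = p * card L"
      using ex_chief_step[OF normal_subgroup_add_singleton M(1) _ MG] by metis
    have "V 7 \<subseteq> aug_ideal L"
      using V_7_subset_aug_of_three_steps[OF p a(1) b(3) b_def Q(5)[OF a] M(5)[OF b(1,2)] L(4)
          Q(4)[OF a(1)] M(4)[OF b(1)] L(3) pM[OF a(1)] L(5)] .
    then show False using contra[OF L(1), of 8] L(2) MG by (auto simp: cardG cardQ L(6) p)
  qed
  show thesis
  proof
    show "card G' = 4" by (simp add: cardG cardQ p \<open>M = {0}\<close>)
    show "h + h = 0" if "h \<in> G'" for h using pM[OF that] by (simp add: p \<open>M = {0}\<close> numeral_2_eq_2)
    show "group_comm h g = 0" if "h \<in> Q" for h g using M(4)[OF that] by (simp add: \<open>M = {0}\<close>)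
    show "group_comm a g \<noteq> 0" using g by (simp add: \<open>M = {0}\<close>)
  qed (use p Q a in auto)
qed

section \<open>A nonzero left-normed commutator\<close>

lemma subgroup_centralizer: "subgroup_add {h. group_comm h g = 0}"
  unfolding subgroup_add_def by (simp add: group_comm_add_left group_comm_uminus_left)

lemma delta_mult_eq_0_iff [simp]: "delta g * r = 0 \<longleftrightarrow> r = 0"
  by (metis delta_inverse_cancel(1) mult_zero_right)

text \<open>
  A suitable pair of entries is a pair whose group commutator lies outside the central subgroup \<open>Q\<close> and
  whose second member does not centralize \<open>G'\<close>.  If there were none, then for \<open>\<alpha>\<close> centralizing \<open>G'\<close>
  and \<open>g\<close> not doing so, both \<open>(\<beta>, g)\<close> and \<open>(\<beta>, \<alpha> g)\<close> would lie in \<open>Q\<close>, and hence so would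
  \<open>(\<beta>, \<alpha>)\<close>; all commutators would lie in \<open>Q\<close>.
\<close>

lemma nonzero_commutator_of_klein_four:
  assumes nQ: "normal_subgroup_add Q" and QG: "Q \<subset> G'"
    and gen: "\<And>h. h \<in> G' \<Longrightarrow> h \<notin> Q \<Longrightarrow> subgroup_add hull (insert h Q) = G'"
    and commQ: "\<And>h g. h \<in> G' \<Longrightarrow> group_comm h g \<in> Q" and Qc: "\<And>h g. h \<in> Q \<Longrightarrow> group_comm h g = 0"
    and two: "\<And>h. h \<in> G' \<Longrightarrow> h + h = 0" and p: "p = 2"
    and a: "a \<in> G'" "group_comm a g \<noteq> 0"
  obtains B A :: "('g, 'k) group_algebra" where "foldl lie_bracket B (replicate 3 A) \<noteq> 0"
proof -
  have sQ: "subgroup_add Q" using nQ by (rule normal_subgroup_addD)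
  have "\<exists>\<beta> \<alpha>. group_comm \<beta> \<alpha> \<notin> Q \<and> (\<exists>h\<in>G'. group_comm h \<alpha> \<noteq> 0)"
  proof (rule ccontr)
    assume "\<not> ?thesis"
    then have *: "group_comm \<beta> \<alpha> \<in> Q" if "h \<in> G'" "group_comm h \<alpha> \<noteq> 0" for \<beta> \<alpha> h
      using that by blast
    have "group_comm \<beta> \<alpha> \<in> Q" for \<beta> \<alpha>
    proof (cases "\<exists>h\<in>G'. group_comm h \<alpha> \<noteq> 0")
      case False
      then have "group_comm a (\<alpha> + g) = group_comm a g" using a(1) by (simp add: group_comm_add_right)
      then have "group_comm \<beta> g \<in> Q" "group_comm \<beta> (\<alpha> + g) \<in> Q" using * a by metis+
      then have "- g + group_comm \<beta> \<alpha> + g \<in> Q"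
        by (simp add: group_comm_add_right subgroup_add_cancel_left[OF sQ])
      from normal_subgroup_add_conj[OF nQ this, of "- g"] show ?thesis
        by (simp only: group_add_normalize)
    qed (use * in blast)
    then have "G' \<subseteq> Q" by (intro commutator_subgroup_least sQ)
    then show False using QG by blast
  qed
  then obtain \<beta> \<alpha> h0 where c: "group_comm \<beta> \<alpha> \<notin> Q" and h0: "h0 \<in> G'" "group_comm h0 \<alpha> \<noteq> 0" by blast
  define c where "c = group_comm \<beta> \<alpha>"
  define d where "d = group_comm c \<alpha>"
  have cG: "c \<in> G'" unfolding c_def by (rule group_comm_in_commutator_subgroup)
  have dQ: "d \<in> Q" unfolding d_def by (rule commQ[OF cG])
  have d0: "d \<noteq> 0"
  proof
    assume "d = 0"
    then have "insert c Q \<subseteq> {h. group_comm h \<alpha> = 0}" using Qc by (auto simp: d_def)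
    then have "G' \<subseteq> {h. group_comm h \<alpha> = 0}"
      unfolding gen[OF cG c[folded c_def], symmetric] by (intro hull_minimal subgroup_centralizer)
    then show False using h0 by blast
  qed
  define A B x y where "A = delta \<alpha>" and "B = delta \<beta>" and "x = delta c - 1" and "y = delta d - 1"
  have sq: "(delta h - 1) * (delta h - 1) = 0" if "h \<in> G'" for h
    using delta_diff_one_power_p[of h] two[OF that] by (simp add: p power2_eq_square numeral_2_eq_2)
  have xx: "x * x = 0" and yy: "y * y = 0" using sq cG dQ QG by (auto simp: x_def y_def)
  have "lie_bracket y r = 0" for r
    using bracket_in_aug_ideal[of d "{0}" r] Qc[OF dQ] by (simp add: y_def aug_ideal_zero)
  then have yc: "y * r = r * y" for r by (simp add: lie_bracket_def)
  have BA: "B * A = A * B + A * B * x"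
    using bracket_delta[of \<beta> \<alpha>] by (simp add: A_def B_def x_def c_def lie_bracket_def algebra_simps)
  have xA: "x * A = A * x + A * (1 + x) * y"
    using bracket_delta[of c \<alpha>] by (simp add: A_def x_def y_def d_def lie_bracket_def algebra_simps)
  have AA: "lie_bracket A A = 0" by (simp add: lie_bracket_def)
  have T1: "lie_bracket B A = A * B * x" by (simp add: lie_bracket_def BA)
  have Tx: "lie_bracket x A = A * (1 + x) * y" by (simp add: lie_bracket_def xA)
  have Ty: "lie_bracket y A = 0" by (simp add: lie_bracket_def yc)
  have xx': "x * (x * r) = 0" for r by (simp add: xx flip: mult.assoc)
  have T2: "lie_bracket (lie_bracket B A) A = A * B * A * (1 + x) * y"
    by (simp add: T1 lie_bracket_mult_left AA Tx xx xx' mult.assoc)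
  \<comment> \<open>\<open>x\<close> and \<open>A\<close> commute up to a multiple of \<open>y\<close>, and \<open>y\<^sup>2 = 0\<close>.\<close>
  have xAy: "x * (A * (r * y)) = A * (x * (r * y))" for r
  proof -
    have "x * A * y = A * x * y" by (simp add: xA distrib_right yy mult.assoc)
    then have "x * A * y * r = A * x * y * r" by simp
    then show ?thesis by (simp add: mult.assoc yc[of r])
  qed
  have "lie_bracket (lie_bracket (lie_bracket B A) A) A = A * A * B * A * x * y"
  proof -
    have 1: "lie_bracket (1 + x) A * y = 0"
      by (simp add: lie_bracket_add_left Tx mult.assoc yy)
    define e where "e = (1 + x) * y"
    have "lie_bracket e A = 0" by (simp only: e_def lie_bracket_mult_left Ty 1) simp
    then have "lie_bracket (A * (B * (A * e))) A = A * (lie_bracket B A * (A * e))"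
      by (simp add: lie_bracket_mult_left AA)
    then have "lie_bracket (A * B * A * (1 + x) * y) A = A * (lie_bracket B A * (A * ((1 + x) * y)))"
      by (simp only: e_def mult.assoc)
    also have "\<dots> = A * (A * B * (x * (A * ((1 + x) * y))))" by (simp add: T1 mult.assoc)
    also have "\<dots> = A * (A * B * (A * (x * ((1 + x) * y))))" by (simp only: xAy)
    also have "\<dots> = A * A * B * A * x * y" by (simp add: distrib_left distrib_right xx' mult.assoc)
    finally show ?thesis by (simp add: T2)
  qed
  moreover have "x * y \<noteq> 0"
  proof
    assume "x * y = 0"
    moreover have "x * y = delta (c + d) - delta c - delta d + delta 0"
      by (simp add: x_def y_def delta_add algebra_simps)
    moreover have "c + d \<noteq> 0" "c \<noteq> 0"
      using c subgroup_add_cancel_right[OF sQ dQ] subgroup_add_zero[OF sQ] unfolding c_def[symmetric] by metis+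
    then have "Poly_Mapping.lookup (delta (c + d) - delta c - delta d + delta 0) 0 = 1"
      using d0 by (simp only: lookup_add lookup_minus lookup_delta) simp
    ultimately show False by simp
  qed
  then have "A * A * B * A * x * y \<noteq> 0" by (simp add: A_def B_def mult.assoc)
  ultimately have "foldl lie_bracket B (replicate 3 A) \<noteq> 0" by (simp add: numeral_3_eq_3)
  then show thesis by (rule that)
qed

text \<open>
  The leading coefficient of \<open>(c - 1)\<^sup>k\<close> is \<open>1\<close>, since \<open>1, c, \<dots>, c\<^sup>k\<close> are distinct for
  \<open>k < \<bar>G'\<bar>\<close>.  The induction also needs that the coefficients at higher multiples vanish.
\<close>

lemma lookup_power_generator:
  assumes c: "c \<in> G'" and gen: "subgroup_add hull {c} = G'" and k: "k < card G'"
  shows "Poly_Mapping.lookup ((delta c - 1) ^ k) (nmul k c) = 1"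
proof -
  have order: "nmul i c \<noteq> 0" if i: "0 < i" "i < card G'" for i
  proof
    assume "nmul i c = 0"
    then have "card (subgroup_add hull {c}) \<le> i"
      using card_image_le[of "{..<i}"] by (simp add: hull_singleton_eq_nmul[OF i(1)])
    then show False using i(2) gen by simp
  qed
  have step: "Poly_Mapping.lookup ((delta c - 1) ^ Suc k) (nmul (Suc i) c)
      = Poly_Mapping.lookup ((delta c - 1) ^ k) (nmul i c) - Poly_Mapping.lookup ((delta c - 1) ^ k) (nmul (Suc i) c)" for k i
    by (simp add: left_diff_distrib lookup_minus lookup_delta_mult)
  have "Poly_Mapping.lookup ((delta c - 1) ^ k) (nmul k c) = 1 \<and>
      (\<forall>i. k < i \<and> i < card G' \<longrightarrow> Poly_Mapping.lookup ((delta c - 1) ^ k) (nmul i c) = 0)"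
    using k
  proof (induction k)
    case 0
    have "Poly_Mapping.lookup (1 :: ('g, 'k) group_algebra) g = (if g = 0 then 1 else 0)" for g
      using lookup_delta[of 0 g] by simp
    then show ?case using order by simp
  next
    case (Suc k)
    have "Poly_Mapping.lookup ((delta c - 1) ^ Suc k) (nmul i c) = 0" if "Suc k < i" "i < card G'" for i
      using Suc that step[of k "i - 1"] by (cases i) (auto simp del: nmul.simps power_Suc)
    moreover have "Poly_Mapping.lookup ((delta c - 1) ^ Suc k) (nmul (Suc k) c) = 1"
      using Suc step[of k k] by (simp del: nmul.simps power_Suc)
    ultimately show ?case by blast
  qed
  then show ?thesis ..
qed

text \<open>
  Bracketing \<open>\<alpha>\<^sup>k \<beta> x\<^sup>k\<close> with \<open>\<alpha>\<close>, where \<open>x = c - 1\<close>, gives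
  \<open>\<alpha>\<^sup>k [\<beta>, \<alpha>] x\<^sup>k + \<alpha>\<^sup>k \<beta> [x\<^sup>k, \<alpha>]\<close>.  The first summand is \<open>\<alpha>\<^sup>k\<^sup>+\<^sup>1 \<beta> x\<^sup>k\<^sup>+\<^sup>1\<close>.  The second one lies in
  \<open>V (k + 2)\<close>, because \<open>[x, \<alpha>] \<in> V 3\<close> exceeds the degree of \<open>x\<close> by two, not only by one.
\<close>

lemma iterated_commutator:
  assumes c: "c = group_comm \<beta> \<alpha>" and br: "lie_bracket (delta c - 1) (delta \<alpha>) \<in> V 3"
  shows "foldl lie_bracket (delta \<beta>) (replicate k (delta \<alpha>))
      - delta \<alpha> ^ k * delta \<beta> * (delta c - 1) ^ k \<in> V (Suc k)"
proof -
  define A B x where "A = delta \<alpha>" and "B = delta \<beta>" and "x = delta c - 1"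
  have xV: "x \<in> V 1"
    unfolding x_def c by (intro delta_in_V_1 group_comm_in_commutator_subgroup)
  have xk: "lie_bracket (x ^ k) A \<in> V (k + 2)" for k
  proof (induction k)
    case 0
    show ?case using two_sided_ideal_zero[OF ideal_V] by simp
  next
    case (Suc k)
    have "x * lie_bracket (x ^ k) A \<in> V (1 + (k + 2))"
      by (rule lie_filtration_mult[OF xV Suc])
    moreover have "lie_bracket x A * x ^ k \<in> V (3 + k)"
      using br lie_filtration_power[OF xV] unfolding x_def A_def by (intro lie_filtration_mult)
    ultimately show ?case
      using two_sided_ideal_add[OF ideal_V[of "k + 3"]] by (simp add: lie_bracket_mult_left add.commute numeral_3_eq_3)
  qed
  have BA: "lie_bracket B A = A * B * x"
    unfolding A_def B_def x_def c by (rule bracket_delta)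
  have AA: "lie_bracket (A ^ k) A = 0" for k
    by (simp add: lie_bracket_def power_commutes)
  have "foldl lie_bracket B (replicate k A) - A ^ k * B * x ^ k \<in> V (Suc k)"
  proof (induction k)
    case 0
    show ?case using two_sided_ideal_zero[OF ideal_V] by simp
  next
    case (Suc k)
    define r where "r = foldl lie_bracket B (replicate k A) - A ^ k * B * x ^ k"
    have "foldl lie_bracket B (replicate (Suc k) A) = lie_bracket (foldl lie_bracket B (replicate k A)) A"
      by (simp flip: replicate_append_same)
    also have "foldl lie_bracket B (replicate k A) = A ^ k * B * x ^ k + r" by (simp add: r_def)
    also have "lie_bracket (A ^ k * B * x ^ k + r) A
        = A ^ Suc k * B * x ^ Suc k + A ^ k * B * lie_bracket (x ^ k) A + lie_bracket r A"
      by (simp only: lie_bracket_add_left lie_bracket_mult_left AA BA power_Suc2[of A] power_Suc[of x])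
        (simp add: algebra_simps)
    finally have "foldl lie_bracket B (replicate (Suc k) A) - A ^ Suc k * B * x ^ Suc k
        = A ^ k * B * lie_bracket (x ^ k) A + lie_bracket r A" by simp
    moreover have "A ^ k * B * lie_bracket (x ^ k) A \<in> V (Suc (Suc k))"
      using xk[of k] two_sided_ideal_mult_left[OF ideal_V] by simp
    moreover have "lie_bracket r A \<in> V (Suc (Suc k))"
      using Suc unfolding r_def[symmetric] by (rule bracket_lie_filtration)
    ultimately show ?case using two_sided_ideal_add[OF ideal_V[of "Suc (Suc k)"]] by simp
  qed
  then show ?thesis by (simp add: A_def B_def x_def)
qed

text \<open>
  Every \<open>\<alpha>\<close> acts on \<open>G'\<close> by multiplication with some \<open>s\<close> that is \<open>1\<close> modulo \<open>p\<close>.  If \<open>s\<close> is \<open>1\<close> modulo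
  \<open>q\<close>, a power of \<open>p\<close> with \<open>q \<ge> 3\<close>, then \<open>(c, \<alpha>)\<close> is a \<open>q\<close>-fold multiple, so that
  \<open>[c - 1, \<alpha>]\<close> is a multiple of a \<open>q\<close>-th power of an element of \<open>V 1\<close> and lies in \<open>V 3\<close>.  For odd \<open>p\<close>
  one takes \<open>q = p\<close>; for \<open>p = 2\<close> one needs \<open>q = 4\<close>.  In that case, if both \<open>\<alpha>\<close> and \<open>\<beta>\<close> act by \<open>3\<close>
  modulo \<open>4\<close>, then \<open>\<beta> \<alpha>\<close> acts by \<open>1\<close> modulo \<open>4\<close>, and \<open>(\<beta>, \<beta> \<alpha>) = (\<beta>, \<alpha>)\<close>.
\<close>

lemma nonzero_commutator_of_cyclic:
  assumes a: "a \<in> G'" and gen: "subgroup_add hull {a} = G'" and n: "n = card G'"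
  obtains B A :: "('g, 'k) group_algebra" where "foldl lie_bracket B (replicate (n - 1) A) \<noteq> 0"
proof (cases "G' = {0}")
  case True
  have "n - 1 = 0" unfolding n True by simp
  then show thesis using that[of 1 1] by simp
next
  case False
  have "subgroup_add hull {0} \<noteq> G'"
    using False hull_same[where S = subgroup_add, OF normal_subgroup_addD[OF normal_subgroup_add_singleton]] by metis
  then have "frattini \<subset> G'" by (rule frattini_psubset)
  then obtain Q where Q: "normal_subgroup_add Q" "frattini \<subseteq> Q" "Q \<subset> G'"
    "\<And>h g. h \<in> G' \<Longrightarrow> group_comm h g \<in> Q"
    using ex_chief_step[OF normal_frattini normal_commutator_subgroup] by (metis order_refl)
  have sQ: "subgroup_add Q" using Q(1) by (rule normal_subgroup_addD)
  obtain e where e: "nmul (p ^ e) a = 0" using ex_p_power_multiple_zero[OF a] .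
  have p2: "2 \<le> p" using prime_p by (rule prime_ge_2_nat)
  have coprime_gen: "a \<in> H" if "subgroup_add H" "nmul k a \<in> H" "\<not> p dvd k" for H k
  proof -
    have "coprime k (p ^ e)"
      using prime_imp_coprime[OF prime_p that(3)] by (simp add: coprime_commute)
    moreover have "k \<noteq> 0" using that(3) by (intro notI) simp
    ultimately show ?thesis
      using nmul_coprime_in[OF that(1,2)] e subgroup_add_zero[OF that(1)] by metis
  qed
  have G'_min: "G' \<subseteq> H" if "subgroup_add H" "a \<in> H" for H
    unfolding gen[symmetric] using that by (intro hull_minimal) auto
  have dvd: "p dvd k" if "nmul k a \<in> Q" for k
    using coprime_gen[OF sQ that] G'_min[OF sQ] Q(3) by blast
  have mult_a: "\<exists>k. h = nmul k a" if "h \<in> G'" for h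
  proof -
    have "h \<in> subgroup_add hull {a}" using that gen by simp
    then show ?thesis using hull_singleton_eq_nmul[of "p ^ e" a] e p2 by auto
  qed
  have act: "\<exists>s. s mod p = 1 \<and> (\<forall>h\<in>G'. - g + h + g = nmul s h)" for g
  proof -
    have "group_comm a g \<in> G'" using Q(3) Q(4)[OF a] by blast
    then obtain k where k: "group_comm a g = nmul k a" using mult_a by blast
    have conj: "- g + a + g = nmul (Suc k) a" by (simp add: conj_eq_group_comm k)
    have "- g + h + g = nmul (Suc k) h" if "h \<in> G'" for h
      using mult_a[OF that] by (auto simp: nmul_conj conj nmul_mult'[symmetric] simp del: nmul.simps)
        (simp only: nmul_mult[symmetric] mult.commute)
    moreover have "p dvd k" using dvd[of k] Q(4)[OF a, of g] by (simp add: k)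
    then have "Suc k mod p = 1" using p2 by (simp add: mod_Suc)
    ultimately show ?thesis by blast
  qed
  define q where "q = (if p = 2 then 4 else p)"
  define good where "good \<alpha> \<longleftrightarrow> (\<exists>s. s mod q = 1 \<and> (\<forall>h\<in>G'. - \<alpha> + h + \<alpha> = nmul s h))" for \<alpha>
  have "\<exists>\<beta> \<alpha>. group_comm \<beta> \<alpha> \<notin> Q \<and> good \<alpha>"
  proof (rule ccontr)
    assume "\<not> ?thesis"
    then have *: "group_comm \<beta> \<alpha> \<in> Q" if "good \<alpha>" for \<beta> \<alpha> using that by blast
    have "group_comm \<beta> \<alpha> \<in> Q" for \<beta> \<alpha>
    proof (cases "good \<alpha> \<or> good \<beta>")
      case True
      then have "group_comm \<beta> \<alpha> \<in> Q \<or> group_comm \<alpha> \<beta> \<in> Q" using * by blast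
      then show ?thesis using subgroup_add_uminus[OF sQ] group_comm_swap by metis
    next
      case bad: False
      obtain s t where s: "s mod p = 1" "\<forall>h\<in>G'. - \<alpha> + h + \<alpha> = nmul s h"
        and t: "t mod p = 1" "\<forall>h\<in>G'. - \<beta> + h + \<beta> = nmul t h" using act by metis
      have p: "p = 2" using bad s t unfolding good_def q_def by metis
      have "s mod 4 \<noteq> 1" "t mod 4 \<noteq> 1" using bad s t p unfolding good_def q_def by auto
      moreover have "s mod 2 = 1" "t mod 2 = 1" using s(1) t(1) p by simp_all
      ultimately have "s mod 4 = 3" "t mod 4 = 3" by presburger+
      then have "(t * s) mod 4 = 1" using mod_mult_eq[of t 4 s] by simp
      moreover have "- (\<beta> + \<alpha>) + h + (\<beta> + \<alpha>) = nmul (t * s) h" if "h \<in> G'" for h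
      proof -
        have "- (\<beta> + \<alpha>) + h + (\<beta> + \<alpha>) = - \<alpha> + (- \<beta> + h + \<beta>) + \<alpha>" by (simp only: group_add_normalize)
        also have "\<dots> = nmul t (nmul s h)" using s t that by (simp add: nmul_conj)
        finally show ?thesis by (simp only: nmul_mult)
      qed
      ultimately have "good (\<beta> + \<alpha>)" unfolding good_def q_def p by auto
      then have "group_comm \<beta> (\<beta> + \<alpha>) \<in> Q" by (rule *)
      then show ?thesis by (simp add: group_comm_add_right)
    qed
    then have "G' \<subseteq> Q" by (intro commutator_subgroup_least sQ)
    then show False using Q(3) by blast
  qed
  then obtain \<beta> \<alpha> s where notQ: "group_comm \<beta> \<alpha> \<notin> Q" and s: "s mod q = 1" "\<forall>h\<in>G'. - \<alpha> + h + \<alpha> = nmul s h"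
    unfolding good_def by blast
  define c where "c = group_comm \<beta> \<alpha>"
  have cG: "c \<in> G'" unfolding c_def by (rule group_comm_in_commutator_subgroup)
  then obtain k where k: "c = nmul k a" using mult_a by blast
  have "\<not> p dvd k"
  proof
    assume "p dvd k"
    then obtain m where "k = p * m" ..
    then have "c \<in> frattini"
      using nmul_p_in_frattini[OF nmul_closed[OF subgroup_commutator_subgroup a]] by (simp add: k nmul_mult)
    then show False using Q(2) notQ c_def by blast
  qed
  have "G' \<subseteq> subgroup_add hull {c}"
    using coprime_gen[OF subgroup_add_hull _ \<open>\<not> p dvd k\<close>, of "{c}"] G'_min[OF subgroup_add_hull, of "{c}"]
      hull_inc[of c "{c}" subgroup_add] by (simp add: k)
  moreover have "subgroup_add hull {c} \<subseteq> G'"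
    using cG by (intro hull_minimal subgroup_commutator_subgroup) auto
  ultimately have gen_c: "subgroup_add hull {c} = G'" by blast
  have br: "lie_bracket (delta c - 1) (delta \<alpha>) \<in> V 3"
  proof -
    define f where "f = (if p = 2 then 2 else 1 :: nat)"
    have qf: "q = p ^ f" by (simp add: q_def f_def)
    have q3: "3 \<le> q" using p2 by (auto simp: q_def)
    define j where "j = s div q"
    have "s = q * j + 1" using s(1) by (metis j_def div_mult_mod_eq mult.commute)
    then have "- \<alpha> + c + \<alpha> = c + nmul q (nmul j c)"
      using s(2) cG by (simp add: nmul_mult nmul_add nmul_commute[of _ _ 1, simplified])
    then have "group_comm c \<alpha> = nmul q (nmul j c)" by (simp add: conj_eq_group_comm)
    then have "delta (group_comm c \<alpha>) - 1 = (delta (nmul j c) - 1) ^ q"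
      by (simp add: qf delta_diff_one_power)
    moreover have "nmul j c \<in> G'" by (rule nmul_closed[OF subgroup_commutator_subgroup cG])
    then have "(delta (nmul j c) - 1) ^ q \<in> V 3"
      using lie_filtration_power[OF delta_in_V_1] V_antimono[OF q3] by blast
    ultimately show ?thesis
      by (simp add: lie_bracket_diff_left bracket_delta two_sided_ideal_mult_left two_sided_ideal_upper_lie_power)
  qed
  define r where "r = (delta c - 1) ^ (n - 1)"
  have "card G' > 0" using finite_G' cG by (auto simp: card_gt_0_iff)
  then have n1: "n - 1 < card G'" "Suc (n - 1) = n" by (auto simp: n)
  have "foldl lie_bracket (delta \<beta>) (replicate (n - 1) (delta \<alpha>)) = delta \<alpha> ^ (n - 1) * delta \<beta> * r"
    using iterated_commutator[OF c_def br, of "n - 1"] V_n n1(2) by (simp add: r_def)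
  moreover have "r \<noteq> 0"
    using lookup_power_generator[OF cG gen_c n1(1)] unfolding r_def[symmetric] by auto
  then have "delta \<alpha> ^ (n - 1) * delta \<beta> * r \<noteq> 0"
    by (simp add: mult.assoc flip: delta_nmul)
  ultimately have "foldl lie_bracket (delta \<beta>) (replicate (n - 1) (delta \<alpha>)) \<noteq> 0" by simp
  then show thesis by (rule that)
qed

lemma ex_nonzero_commutator:
  assumes n: "n = card G'" and V_big: "V (n - 1) \<noteq> {0}"
  obtains B A :: "('g, 'k) group_algebra" where "foldl lie_bracket B (replicate (n - 1) A) \<noteq> 0"
proof (cases "\<exists>a\<in>G'. subgroup_add hull {a} = G'")
  case True
  then show thesis using nonzero_commutator_of_cyclic[OF _ _ n] that by blast
next
  case False
  then have not_cyclic: "subgroup_add hull {a} \<noteq> G'" if "a \<in> G'" for a using that by blast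
  show thesis
  proof (rule not_cyclic_cases[OF V_big[unfolded n] not_cyclic])
    fix Q a g
    assume *: "p = 2" "card G' = 4" "normal_subgroup_add Q" "Q \<subset> G'"
      "\<And>h. h \<in> G' \<Longrightarrow> h \<notin> Q \<Longrightarrow> subgroup_add hull (insert h Q) = G'"
      "\<And>h g. h \<in> G' \<Longrightarrow> group_comm h g \<in> Q" "\<And>h g. h \<in> Q \<Longrightarrow> group_comm h g = 0"
      "\<And>h. h \<in> G' \<Longrightarrow> h + h = 0" "a \<in> G'" "group_comm a g \<noteq> 0"
    obtain B A :: "('g, 'k) group_algebra" where "foldl lie_bracket B (replicate 3 A) \<noteq> 0"
      using nonzero_commutator_of_klein_four[OF *(3-8) *(1) *(9,10)] by blast
    moreover have "n - 1 = 3" using n *(2) by simp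
    ultimately show thesis using that[of B A] by simp
  qed
qed

end

section \<open>Comparison of the two nilpotency indices\<close>

lemma INF_enat_eq_iff:
  "(INF m\<in>S. enat m) = enat k \<longleftrightarrow> k \<in> S \<and> (\<forall>m\<in>S. k \<le> m)"
proof
  assume *: "(INF m\<in>S. enat m) = enat k"
  then have "enat ` S \<noteq> {}" by (auto simp: top_enat_def)
  then have "(INF m\<in>S. enat m) \<in> enat ` S" unfolding Inf_enat_def by (auto intro: LeastI)
  then have "k \<in> S" using * by auto
  moreover have "k \<le> m" if "m \<in> S" for m
    using INF_lower[of m S enat] that * by simp
  ultimately show "k \<in> S \<and> (\<forall>m\<in>S. k \<le> m)" by blast
next
  assume "k \<in> S \<and> (\<forall>m\<in>S. k \<le> m)"
  then show "(INF m\<in>S. enat m) = enat k"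
    by (intro antisym INF_lower INF_greatest) auto
qed

lemma foldl_bracket_zero: "foldl lie_bracket 0 xs = 0"
  by (induction xs) simp_all

lemma lower_lie_power_nonzero:
  fixes A B :: "'a::ring_1"
  assumes "foldl lie_bracket B (replicate k A) \<noteq> 0" "m \<le> Suc k" "1 \<le> m"
  shows "lower_lie_power m \<noteq> ({0} :: 'a set)"
proof
  assume "lower_lie_power m = ({0} :: 'a set)"
  moreover have "foldl lie_bracket B (replicate (m - 1) A) \<in> lower_lie_power m"
    unfolding lower_lie_power_def using assms(3)
    by (intro hull_inc CollectI exI[of _ B] exI[of _ "replicate (m - 1) A"]) simp
  ultimately have "foldl lie_bracket B (replicate (m - 1) A) = 0" by simp
  moreover have "replicate k A = replicate (m - 1) A @ replicate (k - (m - 1)) A"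
    using assms(2) by (simp flip: replicate_add)
  ultimately show False using assms(1) by (simp add: foldl_bracket_zero)
qed

theorem corollary1:
  fixes p :: nat
  assumes "CHAR('k::field) = p" and "p > 0"
    and "lie_nilpotent TYPE(('g::group_add, 'k) group_algebra)"
    and "upper_lie_nilpotency_index TYPE(('g, 'k) group_algebra)
           = enat (card (commutator_subgroup :: 'g set) + 1)"
  shows "lie_nilpotency_index TYPE(('g, 'k) group_algebra)
           = upper_lie_nilpotency_index TYPE(('g, 'k) group_algebra)"
proof -
  define n where "n = card (commutator_subgroup :: 'g set)"
  define delta where "delta = (\<lambda>g :: 'g. Poly_Mapping.single g (1 :: 'k))"
  have upper: "lie_filtration n = ({0} :: ('g, 'k) group_algebra set)"
    and upper_min: "\<And>m. 1 \<le> m \<Longrightarrow> upper_lie_power m = ({0} :: ('g, 'k) group_algebra set) \<Longrightarrow> Suc n \<le> m"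
    using assms(4) unfolding upper_lie_nilpotency_index_def INF_enat_eq_iff n_def by auto
  have "n \<noteq> 0"
  proof
    assume "n = 0"
    then have "(1 :: ('g, 'k) group_algebra) \<in> {0}" using upper by (metis UNIV_I One_nat_def upper_lie_power.simps(2))
    then show False by simp
  qed
  then have fin: "finite (commutator_subgroup :: 'g set)" unfolding n_def by (meson card.infinite)
  have big: "lie_filtration (n - 1) \<noteq> ({0} :: ('g, 'k) group_algebra set)"
    using upper_min[of n] \<open>n \<noteq> 0\<close> by auto
  interpret lie_nilpotent_group_algebra p delta n
  proof
    show "prime p" using assms(1,2) prime_CHAR_semidom by blast
    show "of_nat p = (0 :: 'k)" using assms(1) of_nat_CHAR by blast
  qed (use fin upper delta_def in auto)
  obtain B A :: "('g, 'k) group_algebra" where "foldl lie_bracket B (replicate (n - 1) A) \<noteq> 0"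
    using ex_nonzero_commutator[OF n_def big] .
  then have lower_min: "lower_lie_power m \<noteq> ({0} :: ('g, 'k) group_algebra set)" if "1 \<le> m" "m \<le> n" for m
    using lower_lie_power_nonzero that by fastforce
  have lower: "lower_lie_power (Suc n) = ({0} :: ('g, 'k) group_algebra set)"
    using lower_subset_upper_lie_power[of n] upper two_sided_ideal_zero[OF two_sided_ideal_hull]
    unfolding lower_lie_power_def by blast
  have "lie_nilpotency_index TYPE(('g, 'k) group_algebra) = enat (Suc n)"
    unfolding lie_nilpotency_index_def INF_enat_eq_iff
  proof (intro conjI ballI)
    fix m assume "m \<in> {m. 1 \<le> m \<and> lower_lie_power m = ({0} :: ('g, 'k) group_algebra set)}"
    then have "\<not> m \<le> n" using lower_min[of m] by auto
    then show "Suc n \<le> m" by simp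
  qed (use lower in simp)
  then show ?thesis using assms(4) by (simp add: n_def)
qed

end
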